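(* Let $\sigma>0$ and let $\omega(z)=P(z)+iQ(z)$, where $P,Q$ are real entire functions of the class $E_\sigma$ and $\omega(x)=o(x)$ as $x\to\pm\infty$ on the real axis. Suppose that for some $\tau\in\mathbb{R}$ $$E(x):=P(x)\cos(\sigma x+\tau)+Q(x)\sin(\sigma x+\tau)\ge 0,\qquad x\in\mathbb{R}.$$ Let $d(x):=P(x)Q'(x)-P'(x)Q(x)$. Then the following holds. 1) For all $x\in\mathbb{R}$, $$4\sigma d(x)\ge\bigl\{(\sigma P(x)+Q'(x))\sin(\sigma x+\tau)+(P'(x)-\sigma Q(x))\cos(\sigma x+\tau)\bigr\}^2.\qquad( * )$$ 2) The following conditions are equivalent: (i) inequality $( * )$ is an equality identically (for all $x\in\mathbb{R}$); (ii) for some $c\ge 0$, $\beta\in\mathbb{R}$, the identity $E(x)\equiv c\sin^2(\sigma x+\tau+\beta)$ holds; (iii) for some $\beta\in\mathbb{R}$ and all $k\in\mathbb{Z}$, $E\bigl(\frac{k\pi-\beta-\tau}{\sigma}\bigr)=0$; (iv) for some $c\ge 0$ and $\beta,\gamma\in\mathbb{R}$, $$P(x)\equiv c\sin\beta\,\sin(\sigma x+\tau+\beta)+\gamma\sin(\sigma x+\tau),\qquad Q(x)\equiv c\cos\beta\,\sin(\sigma x+\tau+\beta)-\gamma\cos(\sigma x+\tau).$$ In this case, $d(x)\equiv\gamma^2\sigma$. 3) If $E(x)\not\equiv c\sin^2(\sigma x+\tau+\alpha)$ for every $\alpha\in\mathbb{R}$ and every $c\ge 0$, then for $x_0\in\mathbb{R}$: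 inequality $( * )$ becomes an equality at $x=x_0$ if and only if $E(x_0)=0$.
   Context: An entire function $f$ is of exponential type if there are $A>0,B>0$ with $|f(z)|\le Ae^{B|z|}$ for all $z\in\mathbb{C}$; the infimum of such $B$ is the type $\sigma(f)\ge0$ of $f$. $E_\sigma$ ($\sigma\ge0$) is the class of entire functions $f$ of exponential type with $\sigma(f)\le\sigma$. A function is called real if it takes real values on the real axis. *)

theory Defs
  imports "HOL-Complex_Analysis.Complex_Analysis" "HOL-Library.Landau_Symbols"
begin

definition exp_bounds :: "(complex \<Rightarrow> complex) \<Rightarrow> real set" where
  "exp_bounds f = {B. B > 0 \<and> (\<exists>A>0. \<forall>z. norm (f z) \<le> A * exp (B * norm z))}"

definition exponential_type :: "(complex \<Rightarrow> complex) \<Rightarrow> bool" where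
  "exponential_type f \<longleftrightarrow> f holomorphic_on UNIV \<and> exp_bounds f \<noteq> {}"

text \<open>The infimum below is meaningful only for functions of exponential type: the infimum of the
  empty set of reals is an unspecified number.\<close>

definition exp_type :: "(complex \<Rightarrow> complex) \<Rightarrow> real" where
  "exp_type f = Inf (exp_bounds f)"

definition exp_class :: "real \<Rightarrow> (complex \<Rightarrow> complex) set" where
  "exp_class \<sigma> = {f. exponential_type f \<and> exp_type f \<le> \<sigma>}"

definition real_on_axis :: "(complex \<Rightarrow> complex) \<Rightarrow> bool" where
  "real_on_axis f \<longleftrightarrow> (\<forall>x::real. f (complex_of_real x) \<in> \<real>)"

text \<open>The real function \<open>x \<mapsto> f(x)\<close> obtained from a function that is real on the axis. The derivative
  of a real entire function is again real on the axis, so \<open>axis (deriv f)\<close> is its derivative.\<close>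

definition axis :: "(complex \<Rightarrow> complex) \<Rightarrow> real \<Rightarrow> real" where
  "axis f x = Re (f (complex_of_real x))"

definition E_fun :: "(complex \<Rightarrow> complex) \<Rightarrow> (complex \<Rightarrow> complex) \<Rightarrow> real \<Rightarrow> real \<Rightarrow> real \<Rightarrow> real" where
  "E_fun P Q \<sigma> \<tau> x = axis P x * cos (\<sigma> * x + \<tau>) + axis Q x * sin (\<sigma> * x + \<tau>)"

definition d_fun :: "(complex \<Rightarrow> complex) \<Rightarrow> (complex \<Rightarrow> complex) \<Rightarrow> real \<Rightarrow> real" where
  "d_fun P Q x = axis P x * axis (deriv Q) x - axis (deriv P) x * axis Q x"

text \<open>The expression whose square bounds \<open>4 \<sigma> d(x)\<close> from below.\<close>

definition R_fun :: "(complex \<Rightarrow> complex) \<Rightarrow> (complex \<Rightarrow> complex) \<Rightarrow> real \<Rightarrow> real \<Rightarrow> real \<Rightarrow> real" where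
  "R_fun P Q \<sigma> \<tau> x =
     (\<sigma> * axis P x + axis (deriv Q) x) * sin (\<sigma> * x + \<tau>)
   + (axis (deriv P) x - \<sigma> * axis Q x) * cos (\<sigma> * x + \<tau>)"

definition canonical_form ::
  "(complex \<Rightarrow> complex) \<Rightarrow> (complex \<Rightarrow> complex) \<Rightarrow> real \<Rightarrow> real \<Rightarrow> real \<Rightarrow> real \<Rightarrow> real \<Rightarrow> bool" where
  "canonical_form P Q \<sigma> \<tau> c \<beta> \<gamma> \<longleftrightarrow>
     (\<forall>x. axis P x = c * sin \<beta> * sin (\<sigma> * x + \<tau> + \<beta>) + \<gamma> * sin (\<sigma> * x + \<tau>)) \<and>
     (\<forall>x. axis Q x = c * cos \<beta> * sin (\<sigma> * x + \<tau> + \<beta>) - \<gamma> * cos (\<sigma> * x + \<tau>))"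

end

theory Submission
  imports Defs "HOL-Real_Asymp.Real_Asymp"
begin

text \<open>
  Write \<open>\<theta> = \<sigma> * x + \<tau>\<close>, and for an angle \<open>\<alpha>\<close> let \<open>G\<^sub>\<alpha> = P cos \<alpha> + Q sin \<alpha>\<close>, again an entire
  function of type at most \<open>\<sigma>\<close> that is \<open>o(x)\<close> on the real axis. At the points where
  \<open>\<theta> = k * \<pi> + \<alpha>\<close> one has \<open>G\<^sub>\<alpha> = (-1)\<^sup>k E\<close>. These are the zeros \<open>x\<^sub>k\<close> of \<open>sin (\<theta> - \<alpha>)\<close>, and the
  growth of \<open>G\<^sub>\<alpha>\<close> is just small enough for the interpolation formula
  \<open>- (G\<^sub>\<alpha> / sin (\<theta> - \<alpha>))' = (1/\<sigma>) \<Sum>\<^sub>k E(x\<^sub>k) / (x - x\<^sub>k)\<^sup>2\<close>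
  (\<open>sine_interpolation_of_derivative\<close>). Since \<open>E \<ge> 0\<close>, the right-hand side is nonnegative.

  Multiplying by \<open>sin\<^sup>2 (\<theta> - \<alpha>)\<close> shows that for every fixed \<open>x\<close> a certain quadratic form in
  \<open>(cos \<alpha>, sin \<alpha>)\<close> is nonnegative. Four times its determinant, computed in the basis rotated by \<open>\<theta>\<close>,
  is \<open>4 \<sigma> d - R\<^sup>2\<close> (\<open>slice_form_eq\<close>, \<open>discriminant_eq\<close>), which gives the inequality.
  The leading coefficient in that basis is \<open>\<sigma> E(x)\<close>. If it vanishes, nonnegativity forces the mixed
  coefficient to vanish too and equality holds at \<open>x\<close>. If it does not vanish but equality holds at \<open>x\<close>,
  then the form vanishes for some \<open>\<alpha>\<close> with \<open>sin (\<theta> - \<alpha>) \<noteq> 0\<close>; a sum of nonnegative terms is then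
  zero, so \<open>E(x\<^sub>k) = 0\<close> for all \<open>k\<close>.

  In that exceptional case \<open>G\<^sub>\<alpha>\<close> vanishes at all zeros of \<open>sin (\<theta> - \<alpha>)\<close> and is a multiple of it, by
  the interpolation formula once more. The zeros of \<open>E\<close> being double, the same argument applies to
  the orthogonal combination of \<open>P\<close> and \<open>Q\<close> after adding a multiple of \<open>cos (\<theta> - \<alpha>)\<close>, and \<open>P\<close> and \<open>Q\<close>
  are thereby determined (\<open>E_zero_at_nodes_imp_canonical_form\<close>). The remaining implications are
  computations.

  The analytic input is the bound \<open>(\<epsilon> \<bar>z\<bar> + C) exp (\<sigma> \<bar>Im z\<bar>)\<close>, for every \<open>\<epsilon> > 0\<close> with a suitable \<open>C\<close>, for
  entire functions of type at most \<open>\<sigma>\<close> that are \<open>o(x)\<close> on the real axis (\<open>sublinear_classI\<close>). It comes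
  from the Phragmen--Lindelof principle, first in the quadrants and then in the half-planes.
\<close>

section \<open>Phragmen--Lindelof principles\<close>

text \<open>The maximum modulus principle on \<open>S \<inter> cball 0 R\<close>, applied to
  \<open>f * exp (- \<eta> * u)\<close> with \<open>R\<close> so large that the arc \<open>|z| = R\<close> is harmless; then
  \<open>\<eta> \<longrightarrow> 0\<close>. The comparison function \<open>u\<close> has to beat the growth of \<open>f\<close> inside \<open>S\<close>, and choosing
  it is all that remains to be done for a particular domain.\<close>

lemma phragmen_lindelof_principle:
  fixes f u :: "complex \<Rightarrow> complex" and S :: "complex set"
  assumes S: "closed S" and f: "f holomorphic_on S" and u: "u holomorphic_on S"
    and u_nonneg: "\<And>z. z \<in> S \<Longrightarrow> Re (u z) \<ge> 0"
    and bd: "\<And>z. z \<in> frontier S \<Longrightarrow> norm (f z) \<le> M"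
    and far: "\<And>\<eta>. \<eta> > 0 \<Longrightarrow> \<exists>r. \<forall>z\<in>S. norm z \<ge> r \<longrightarrow> norm (f z) * exp (- \<eta> * Re (u z)) \<le> M"
    and z: "z \<in> S"
  shows "norm (f z) \<le> M"
proof -
  have damped: "norm (f z) * exp (- \<eta> * Re (u z)) \<le> M" if \<eta>: "\<eta> > 0" for \<eta>
  proof -
    obtain r where r: "\<And>w. w \<in> S \<Longrightarrow> norm w \<ge> r \<Longrightarrow> norm (f w) * exp (- \<eta> * Re (u w)) \<le> M"
      using far[OF \<eta>] by blast
    define R where "R = max r (norm z)"
    define T where "T = S \<inter> cball 0 R"
    define h where "h = (\<lambda>w. f w * exp (- of_real \<eta> * u w))"
    have nh: "norm (h w) = norm (f w) * exp (- \<eta> * Re (u w))" for w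
      by (simp add: h_def norm_mult)
    have hol: "h holomorphic_on S"
      unfolding h_def by (intro holomorphic_intros f u)
    have "closed T" unfolding T_def using S by (intro closed_Int) auto
    have "T \<subseteq> S" by (auto simp: T_def)
    have "norm (h z) \<le> M"
    proof (rule maximum_modulus_frontier[where S = T and f = h])
      show "h holomorphic_on interior T"
        using hol \<open>T \<subseteq> S\<close> interior_subset holomorphic_on_subset by blast
      show "continuous_on (closure T) h"
        using hol \<open>T \<subseteq> S\<close> \<open>closed T\<close>
        by (metis closure_closed continuous_on_subset holomorphic_on_imp_continuous_on)
      show "bounded T" by (auto simp: T_def)
      show "z \<in> T" using z by (auto simp: T_def R_def)
      fix w assume "w \<in> frontier T"
      then have w: "(w \<in> frontier S \<or> norm w = R) \<and> w \<in> S"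
        using S frontier_subset_closed[OF S] by (auto simp: T_def frontier_Int_closed)
      show "norm (h w) \<le> M"
      proof (cases "norm w = R")
        case True then show ?thesis using w r[of w] by (auto simp: nh R_def)
      next
        case False
        then have "norm (f w) \<le> M" using w bd by auto
        moreover have "norm (f w) * exp (- \<eta> * Re (u w)) \<le> norm (f w) * 1"
          using u_nonneg[of w] w that by (intro mult_left_mono) auto
        ultimately show ?thesis by (simp add: nh)
      qed
    qed
    then show ?thesis by (simp add: nh)
  qed
  have "((\<lambda>\<eta>. norm (f z) * exp (- \<eta> * Re (u z))) \<longlongrightarrow> norm (f z) * exp (- 0 * Re (u z))) (at_right 0)"
    by (intro tendsto_intros)
  moreover have "eventually (\<lambda>\<eta>. norm (f z) * exp (- \<eta> * Re (u z)) \<le> M) (at_right 0)"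
    using damped by (auto simp: eventually_at_right_less intro: eventually_mono[OF eventually_at_right_less])
  ultimately show ?thesis
    using tendsto_upperbound[of _ _ "at_right (0::real)" M] by fastforce
qed

text \<open>If the square of \<open>v\<close> stays within an angle of \<open>\<pi>/4\<close> of the positive axis, then \<open>v\<close> stays within
  \<open>\<pi>/8\<close> of it and \<open>v ^ 3\<close> within \<open>3\<pi>/8 < \<pi>/2\<close>. This makes \<open>w powr (3/2)\<close>, a function of order
  larger than 1, a comparison function for a right angle; the constant \<open>1/32\<close> is not sharp.\<close>
lemma cube_in_narrow_sector:
  fixes v :: complex
  assumes "Re v > 0" "Re (v\<^sup>2) \<ge> \<bar>Im (v\<^sup>2)\<bar>"
  shows "Re (v ^ 3) \<ge> norm v ^ 3 / 32"
proof -
  define a b where "a = Re v" and "b = Im v"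
  have a: "a > 0" and ab: "a\<^sup>2 - b\<^sup>2 \<ge> 2 * \<bar>a * b\<bar>"
    using assms by (auto simp: a_def b_def power2_eq_square abs_mult mult.commute)
  have b: "\<bar>b\<bar> \<le> a / 2"
  proof (rule ccontr)
    assume "\<not> \<bar>b\<bar> \<le> a / 2"
    then have "2 * \<bar>a * b\<bar> \<ge> a * a"
      using a by (simp add: abs_mult)
    moreover have "b\<^sup>2 > 0" using \<open>\<not> \<bar>b\<bar> \<le> a / 2\<close> a by auto
    ultimately show False using ab by (simp add: power2_eq_square)
  qed
  then have b2: "b\<^sup>2 \<le> a\<^sup>2 / 4"
    using power_mono[OF b, of 2] by (simp add: power_divide)
  have "norm v \<le> \<bar>a\<bar> + \<bar>b\<bar>" unfolding a_def b_def by (rule cmod_le)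
  then have "norm v \<le> 2 * a" using b a by simp
  then have "norm v ^ 3 \<le> (2 * a) ^ 3" by (rule power_mono) simp
  moreover have "Re (v ^ 3) = a * (a\<^sup>2 - 3 * b\<^sup>2)"
    by (simp add: power3_eq_cube power2_eq_square a_def b_def algebra_simps)
  moreover have "a * (a\<^sup>2 - 3 * b\<^sup>2) \<ge> a * (a\<^sup>2 / 4)"
    using a b2 by (intro mult_left_mono) auto
  ultimately show ?thesis by (simp add: power3_eq_cube power2_eq_square)
qed

text \<open>A right angle tolerates growth of any order below 2, hence exponential growth. The comparison
  function is the cube of \<open>csqrt (w + 1)\<close>; the shift by 1 keeps its argument off the branch cut,
  the vertex of the angle included.\<close>
lemma phragmen_lindelof_right_angle:
  fixes f :: "complex \<Rightarrow> complex"
  defines "S \<equiv> {w. \<bar>Im w\<bar> \<le> Re w}"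
  assumes f: "f holomorphic_on S"
    and growth: "\<And>w. w \<in> S \<Longrightarrow> norm (f w) \<le> A * exp (B * norm w)"
    and bd: "\<And>w. \<bar>Im w\<bar> = Re w \<Longrightarrow> norm (f w) \<le> M"
    and M: "M > 0" and w: "w \<in> S"
  shows "norm (f w) \<le> M"
proof (rule phragmen_lindelof_principle[OF _ f _ _ _ _ w])
  define u where "u = (\<lambda>w. csqrt (w + 1) ^ 3)"
  show "closed S" unfolding S_def by (intro closed_Collect_le continuous_intros)
  have notneg: "w + 1 \<notin> \<real>\<^sub>\<le>\<^sub>0" if "w \<in> S" for w
    using that by (auto simp: S_def complex_nonpos_Reals_iff)
  show "u holomorphic_on S"
    unfolding u_def using notneg by (auto intro!: holomorphic_intros)
  have lower: "Re (u w) \<ge> norm w powr (3/2) / 32" if "w \<in> S" for w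
  proof -
    have re: "Re w \<ge> 0" using that by (auto simp: S_def)
    define v where "v = csqrt (w + 1)"
    have v2: "v\<^sup>2 = w + 1" by (simp add: v_def)
    have "Re v > 0"
    proof (rule ccontr)
      assume "\<not> Re v > 0"
      then have "Re v = 0" using Re_csqrt[of "w + 1"] by (simp add: v_def)
      then have "Re (v\<^sup>2) \<le> 0" by (simp add: power2_eq_square)
      then show False using re by (simp add: v2)
    qed
    then have "Re (v ^ 3) \<ge> norm v ^ 3 / 32"
      using that by (intro cube_in_narrow_sector) (auto simp: v2 S_def)
    moreover have "norm w powr (3/2) \<le> norm v ^ 3"
    proof -
      have "(norm w)\<^sup>2 \<le> (norm (w + 1))\<^sup>2"
        unfolding cmod_power2 using re by (auto simp: power2_eq_square algebra_simps)
      then have "norm w \<le> norm (w + 1)" by (rule power2_le_imp_le) simp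
      also have "\<dots> = norm v ^ 2" by (simp add: norm_power flip: v2)
      finally have "norm w powr (3/2) \<le> (norm v ^ 2) powr (3/2)"
        by (intro powr_mono2) auto
      also have "\<dots> = norm v ^ 3"
        using \<open>Re v > 0\<close> by (subst powr_realpow[symmetric], force, subst powr_powr) (simp flip: powr_numeral)
      finally show ?thesis .
    qed
    ultimately show ?thesis by (simp add: u_def v_def)
  qed
  show "Re (u w) \<ge> 0" if "w \<in> S" for w
    using lower[OF that] by (meson divide_nonneg_nonneg order_trans powr_ge_zero zero_le_numeral)
  show "norm (f w) \<le> M" if "w \<in> frontier S" for w
  proof (rule bd)
    have "w \<in> S" using that frontier_subset_closed[OF \<open>closed S\<close>] by auto
    moreover have "\<not> \<bar>Im w\<bar> < Re w"
    proof
      assume "\<bar>Im w\<bar> < Re w"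
      moreover have "open {w. \<bar>Im w\<bar> < Re w}" by (intro open_Collect_less continuous_intros)
      ultimately have "w \<in> interior S"
        by (intro interiorI[of "{w. \<bar>Im w\<bar> < Re w}"]) (auto simp: S_def)
      then show False using that by (simp add: frontier_def)
    qed
    ultimately show "\<bar>Im w\<bar> = Re w" by (auto simp: S_def)
  qed
  fix \<eta> :: real assume \<eta>: "\<eta> > 0"
  have "((\<lambda>x. A * exp (B * x - (\<eta> / 32) * x powr (3/2))) \<longlongrightarrow> 0) at_top"
    using \<eta> by real_asymp
  then have "eventually (\<lambda>x. A * exp (B * x - (\<eta> / 32) * x powr (3/2)) < M) at_top"
    using M by (rule order_tendstoD)
  then obtain r where r: "\<And>x. x \<ge> r \<Longrightarrow> A * exp (B * x - (\<eta> / 32) * x powr (3/2)) < M"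
    by (auto simp: eventually_at_top_linorder)
  show "\<exists>r. \<forall>z\<in>S. r \<le> norm z \<longrightarrow> norm (f z) * exp (- \<eta> * Re (u z)) \<le> M"
  proof (intro exI[of _ r] ballI impI)
    fix z assume z: "z \<in> S" "r \<le> norm z"
    have "norm (f z) * exp (- \<eta> * Re (u z))
        \<le> A * exp (B * norm z) * exp (- \<eta> * (norm z powr (3/2) / 32))"
      using growth[OF z(1)] lower[OF z(1)] \<eta>
      by (intro mult_mono) (auto intro: order_trans[OF norm_ge_zero])
    also have "\<dots> = A * exp (B * norm z - (\<eta> / 32) * norm z powr (3/2))"
      by (simp add: mult.assoc flip: exp_add)
    also have "\<dots> \<le> M" using r[OF z(2)] by simp
    finally show "norm (f z) * exp (- \<eta> * Re (u z)) \<le> M" .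
  qed
qed

text \<open>Exponential growth is critical for a half-plane: \<open>exp (- \<i> * z)\<close> is bounded on the real axis and
  unbounded above it. What has to be excluded is a positive exponential rate along the imaginary
  axis. Given that, the two quadrants can be treated separately and then put together.\<close>
lemma phragmen_lindelof_half_plane:
  fixes f :: "complex \<Rightarrow> complex"
  defines "H \<equiv> {z. Im z \<ge> 0}"
  assumes f: "f holomorphic_on H"
    and growth: "\<And>z. z \<in> H \<Longrightarrow> norm (f z) \<le> A * exp (B * norm z)"
    and imag: "\<And>\<delta>. \<delta> > 0 \<Longrightarrow> \<exists>C. \<forall>y\<ge>0. norm (f (\<i> * of_real y)) \<le> C * exp (\<delta> * y)"
    and bd: "\<And>x::real. norm (f (of_real x)) \<le> M"
    and M: "M > 0" and z: "z \<in> H"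
  shows "norm (f z) \<le> M"
proof -
  have exp_bounded: "\<exists>K>0. \<forall>z\<in>H. norm (f z) \<le> K * exp (\<delta> * Im z)" if \<delta>: "\<delta> > 0" for \<delta>
  proof -
    obtain C where C: "\<And>y. y \<ge> 0 \<Longrightarrow> norm (f (\<i> * of_real y)) \<le> C * exp (\<delta> * y)"
      using imag[OF \<delta>] by blast
    define K where "K = max C M"
    have K: "K > 0" using M by (simp add: K_def)
    define h where "h = (\<lambda>z. f z * exp (\<i> * of_real \<delta> * z))"
    have nh: "norm (h z) = norm (f z) * exp (- \<delta> * Im z)" for z
      by (simp add: h_def norm_mult)
    have hH: "h holomorphic_on H" unfolding h_def by (intro holomorphic_intros f)
    have growth_h: "norm (h z) \<le> A * exp (B * norm z)" if "z \<in> H" for z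
    proof -
      have "norm (h z) \<le> norm (f z) * 1"
        unfolding nh using that \<delta> by (intro mult_left_mono) (auto simp: H_def)
      then show ?thesis using growth[OF that] by simp
    qed
    have real_h: "norm (h (of_real x)) \<le> K" for x
      using bd[of x] by (simp add: nh K_def)
    have imag_h: "norm (h (\<i> * of_real y)) \<le> K" if "y \<ge> 0" for y
    proof -
      have "norm (h (\<i> * of_real y)) \<le> C * exp (\<delta> * y) * exp (- \<delta> * y)"
        unfolding nh using C[OF that] by (intro mult_mono) (auto intro: order_trans[OF norm_ge_zero])
      also have "\<dots> = C" by (simp add: exp_minus)
      finally show ?thesis by (simp add: K_def)
    qed
    \<comment> \<open>Each of the two quadrants is a rotated and rescaled copy of the standard right angle.\<close>
    have rotated: "norm (h (c * w)) \<le> K"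
      if c: "c = Complex s t" "\<bar>s\<bar> = 1" "t = 1" and w: "\<bar>Im w\<bar> \<le> Re w" for c s t w
    proof (rule phragmen_lindelof_right_angle[where f = "\<lambda>w. h (c * w)" and A = "\<bar>A\<bar>" and B = "\<bar>B\<bar> * norm c"])
      have inH: "c * w \<in> H" if "\<bar>Im w\<bar> \<le> Re w" for w
        using that c by (auto simp: H_def abs_if split: if_splits)
      have "(h \<circ> (\<lambda>w. c * w)) holomorphic_on {w. \<bar>Im w\<bar> \<le> Re w}"
        by (rule holomorphic_on_compose_gen[OF _ hH]) (use inH in \<open>auto intro!: holomorphic_intros\<close>)
      then show "(\<lambda>w. h (c * w)) holomorphic_on {w. \<bar>Im w\<bar> \<le> Re w}" by (simp add: o_def)
      fix w assume "w \<in> {w. \<bar>Im w\<bar> \<le> Re w}"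
      then have "norm (h (c * w)) \<le> A * exp (B * norm (c * w))" by (intro growth_h inH) auto
      also have "\<dots> \<le> \<bar>A\<bar> * exp (\<bar>B\<bar> * norm c * norm w)"
      proof (intro mult_mono)
        have "B * norm (c * w) \<le> \<bar>B\<bar> * norm (c * w)" by (intro mult_right_mono) auto
        then show "exp (B * norm (c * w)) \<le> exp (\<bar>B\<bar> * norm c * norm w)"
          by (simp add: norm_mult mult.assoc)
      qed auto
      finally show "norm (h (c * w)) \<le> \<bar>A\<bar> * exp (\<bar>B\<bar> * norm c * norm w)" .
    next
      fix w assume w: "\<bar>Im w\<bar> = Re w"
      then have "c * w = of_real (Re (c * w)) \<or> (c * w = \<i> * of_real (Im (c * w)) \<and> Im (c * w) \<ge> 0)"
        using c by (auto simp: complex_eq_iff abs_if split: if_splits)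
      then show "norm (h (c * w)) \<le> K" using real_h imag_h by metis
    qed (use K w in auto)
    have "norm (f z) \<le> K * exp (\<delta> * Im z)" if "z \<in> H" for z
    proof -
      define s where "s = (if Re z \<ge> 0 then 1 else - 1 :: real)"
      define c where "c = Complex s 1"
      have "c \<noteq> 0" by (auto simp: c_def complex_eq_iff)
      then have zc: "z = c * (z / c)" by simp
      have "\<bar>Im (z / c)\<bar> \<le> Re (z / c)"
        using that by (auto simp: c_def s_def H_def Re_divide Im_divide)
      then have "norm (h z) \<le> K"
        by (subst zc, intro rotated[of _ s 1]) (auto simp: c_def s_def)
      then show ?thesis by (simp add: nh exp_minus field_simps)
    qed
    then show ?thesis using K by blast
  qed
  \<comment> \<open>After damping, \<open>f\<close> is bounded by some constant \<open>K\<close> in the whole half-plane, and a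
     comparison function of merely logarithmic growth suffices to replace \<open>K\<close> by \<open>M\<close>.\<close>
  have damped: "norm (f z) * exp (- \<delta> * Im z) \<le> M" if \<delta>: "\<delta> > 0" for \<delta>
  proof -
    obtain K where K: "K > 0" "\<And>z. z \<in> H \<Longrightarrow> norm (f z) \<le> K * exp (\<delta> * Im z)"
      using exp_bounded[OF \<delta>] by blast
    define h where "h = (\<lambda>z. f z * exp (\<i> * of_real \<delta> * z))"
    have nh: "norm (h z) = norm (f z) * exp (- \<delta> * Im z)" for z
      by (simp add: h_def norm_mult)
    have hK: "norm (h z) \<le> K" if "z \<in> H" for z
      using K(2)[OF that] by (simp add: nh exp_minus field_simps)
    define u where "u = (\<lambda>z. Ln (2 - \<i> * z))"
    have pos: "Re (2 - \<i> * z) > 1" if "z \<in> H" for z using that by (simp add: H_def)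
    have re_u: "Re (u z) = ln (norm (2 - \<i> * z))" if "z \<in> H" for z
    proof -
      have "2 - \<i> * z \<noteq> 0" using pos[OF that] by (metis zero_complex.sel(1) not_one_less_zero)
      then show ?thesis by (simp add: u_def)
    qed
    have "norm (h z) \<le> M"
    proof (rule phragmen_lindelof_principle[where S = H and f = h and u = u])
      show "closed H" unfolding H_def by (intro closed_Collect_le continuous_intros)
      show "h holomorphic_on H" unfolding h_def by (intro holomorphic_intros f)
      have "2 - \<i> * z \<notin> \<real>\<^sub>\<le>\<^sub>0" if "z \<in> H" for z
        using pos[OF that] unfolding complex_nonpos_Reals_iff by linarith
      then show "u holomorphic_on H" unfolding u_def by (intro holomorphic_intros)
      show "Re (u z) \<ge> 0" if "z \<in> H" for z
        using pos[OF that] complex_Re_le_cmod[of "2 - \<i> * z"] by (subst re_u[OF that]) auto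
      have "H = {z. \<i> \<bullet> z \<ge> 0}" by (auto simp: H_def inner_complex_def)
      then have "frontier H = {z. Im z = 0}"
        by (simp only: frontier_halfspace_ge simp_thms complex_i_not_zero not_False_eq_True)
           (auto simp: inner_complex_def)
      then show "norm (h w) \<le> M" if "w \<in> frontier H" for w
        using that bd[of "Re w"] by (auto simp: nh of_real_Re complex_is_Real_iff)
      show "z \<in> H" by fact
      fix \<eta> :: real assume \<eta>: "\<eta> > 0"
      have "((\<lambda>x. K * (x - 2) powr (- \<eta>)) \<longlongrightarrow> 0) at_top"
        using \<eta> by real_asymp
      then have "eventually (\<lambda>x. K * (x - 2) powr (- \<eta>) < M) at_top"
        using M by (rule order_tendstoD)
      then obtain r where r: "\<And>x. x \<ge> r \<Longrightarrow> K * (x - 2) powr (- \<eta>) < M"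
        by (auto simp: eventually_at_top_linorder)
      show "\<exists>r. \<forall>z\<in>H. r \<le> norm z \<longrightarrow> norm (h z) * exp (- \<eta> * Re (u z)) \<le> M"
      proof (intro exI[of _ "max r 3"] ballI impI)
        fix z assume z: "z \<in> H" "max r 3 \<le> norm z"
        have ge: "norm (2 - \<i> * z) \<ge> norm z - 2"
          using norm_triangle_ineq2[of "\<i> * z" 2] by (simp add: norm_mult norm_minus_commute)
        have "norm (h z) * exp (- \<eta> * Re (u z)) \<le> K * (norm z - 2) powr (- \<eta>)"
        proof (intro mult_mono hK z)
          have "exp (- \<eta> * Re (u z)) = norm (2 - \<i> * z) powr (- \<eta>)"
            using ge z by (auto simp: powr_def re_u)
          also have "\<dots> \<le> (norm z - 2) powr (- \<eta>)"
            using ge z \<eta> by (intro powr_mono2') auto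
          finally show "exp (- \<eta> * Re (u z)) \<le> (norm z - 2) powr (- \<eta>)" .
        qed (use K in auto)
        also have "\<dots> \<le> M" using r[of "norm z"] z by simp
        finally show "norm (h z) * exp (- \<eta> * Re (u z)) \<le> M" .
      qed
    qed
    then show ?thesis by (simp add: nh)
  qed
  have "((\<lambda>\<delta>. norm (f z) * exp (- \<delta> * Im z)) \<longlongrightarrow> norm (f z) * exp (- 0 * Im z)) (at_right 0)"
    by (intro tendsto_intros)
  moreover have "eventually (\<lambda>\<delta>. norm (f z) * exp (- \<delta> * Im z) \<le> M) (at_right 0)"
    using damped by (auto intro: eventually_mono[OF eventually_at_right_less])
  ultimately show ?thesis
    using tendsto_upperbound[of _ _ "at_right (0::real)" M] by fastforce
qed

section \<open>Entire functions that are sublinear on the real axis\<close>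

lemma exp_class_growth:
  assumes "f \<in> exp_class \<sigma>" "\<delta> > 0"
  shows "\<exists>A>0. \<forall>z. norm (f z) \<le> A * exp ((\<sigma> + \<delta>) * norm z)"
proof -
  have "exp_bounds f \<noteq> {}" "Inf (exp_bounds f) < \<sigma> + \<delta>"
    using assms by (auto simp: exp_class_def exponential_type_def exp_type_def)
  then obtain B where B: "B \<in> exp_bounds f" "B < \<sigma> + \<delta>"
    using cInf_lessD by blast
  then obtain A where A: "A > 0" "\<And>z. norm (f z) \<le> A * exp (B * norm z)"
    by (auto simp: exp_bounds_def)
  have "norm (f z) \<le> A * exp ((\<sigma> + \<delta>) * norm z)" for z
  proof -
    have "A * exp (B * norm z) \<le> A * exp ((\<sigma> + \<delta>) * norm z)"
      using A(1) B(2) by (intro mult_left_mono) (auto intro: mult_right_mono)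
    then show ?thesis using A(2)[of z] by simp
  qed
  then show ?thesis using A(1) by blast
qed

text \<open>The entire functions of type at most \<open>\<sigma>\<close> that are \<open>o(x)\<close> on the real axis, described by a bound in
  the whole plane. In this form the class is visibly a vector space, and the bound is exactly the one
  that contour integrals consume.\<close>
definition sublinear_class :: "real \<Rightarrow> (complex \<Rightarrow> complex) set" where
  "sublinear_class \<sigma> = {f. f holomorphic_on UNIV \<and>
     (\<forall>\<epsilon>>0. \<exists>C. \<forall>z. norm (f z) \<le> (\<epsilon> * norm z + C) * exp (\<sigma> * \<bar>Im z\<bar>))}"

text \<open>Apply the half-plane principle to the quotient of \<open>f z * exp (\<i> * \<sigma> * z)\<close> by
  \<open>z + \<i> * (C / \<epsilon>)\<close>. The shift \<open>C / \<epsilon>\<close> is chosen so that the modulus of the denominator is comparable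
  to \<open>\<bar>x\<bar> + C / \<epsilon>\<close> on the real axis, so that the quotient is bounded there by \<open>2 * \<epsilon>\<close>; thus a small
  slope on the axis stays small in the plane, and \<open>C\<close> enters only through the additive constant.\<close>
lemma upper_half_plane_estimate:
  fixes f :: "complex \<Rightarrow> complex"
  assumes f: "f holomorphic_on UNIV"
    and growth: "\<And>\<delta>. \<delta> > 0 \<Longrightarrow> \<exists>A>0. \<forall>z. norm (f z) \<le> A * exp ((\<sigma> + \<delta>) * norm z)"
    and \<sigma>: "\<sigma> \<ge> 0" and \<epsilon>: "\<epsilon> > 0" and C: "C > 0"
    and bd: "\<And>x. norm (f (of_real x)) \<le> \<epsilon> * \<bar>x\<bar> + C"
    and z: "Im z \<ge> 0"
  shows "norm (f z) \<le> 2 * (\<epsilon> * norm z + C) * exp (\<sigma> * Im z)"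
proof -
  define \<Lambda> where "\<Lambda> = C / \<epsilon>"
  have \<Lambda>: "\<Lambda> > 0" "\<epsilon> * \<Lambda> = C" using \<epsilon> C by (auto simp: \<Lambda>_def)
  define h where "h = (\<lambda>z. f z * exp (\<i> * of_real \<sigma> * z) / (z + \<i> * of_real \<Lambda>))"
  have nh: "norm (h z) = norm (f z) * exp (- \<sigma> * Im z) / norm (z + \<i> * of_real \<Lambda>)" for z
    by (simp add: h_def norm_mult norm_divide)
  have den: "norm (z + \<i> * of_real \<Lambda>) \<ge> \<Lambda>" if "Im z \<ge> 0" for z
    using abs_Im_le_cmod[of "z + \<i> * of_real \<Lambda>"] that \<Lambda> by simp
  obtain A where A: "A > 0" "\<And>z. norm (f z) \<le> A * exp ((\<sigma> + 1) * norm z)"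
    using growth[of 1] by auto
  have "norm (h z) \<le> 2 * \<epsilon>"
  proof (rule phragmen_lindelof_half_plane[where f = h])
    show "h holomorphic_on {z. Im z \<ge> 0}"
      unfolding h_def using den \<Lambda>
      by (intro holomorphic_intros holomorphic_on_subset[OF f]) fastforce+
    show "norm (h z) \<le> (A / \<Lambda>) * exp ((\<sigma> + 1) * norm z)" if "z \<in> {z. Im z \<ge> 0}" for z
    proof -
      have "norm (h z) \<le> A * exp ((\<sigma> + 1) * norm z) * 1 / \<Lambda>"
        unfolding nh using A den[of z] \<Lambda> \<sigma> that by (intro frac_le mult_mono) auto
      then show ?thesis by simp
    qed
    fix \<delta> :: real assume "\<delta> > 0"
    then obtain A where A: "A > 0" "\<And>z. norm (f z) \<le> A * exp ((\<sigma> + \<delta>) * norm z)"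
      using growth by blast
    have "norm (h (\<i> * of_real y)) \<le> (A / \<Lambda>) * exp (\<delta> * y)" if "y \<ge> 0" for y
    proof -
      have "norm (h (\<i> * of_real y)) \<le> A * exp ((\<sigma> + \<delta>) * y) * exp (- \<sigma> * y) / \<Lambda>"
        unfolding nh using A(1) A(2)[of "\<i> * of_real y"] den[of "\<i> * of_real y"] \<Lambda> that
        by (intro frac_le mult_mono) (auto simp: norm_mult)
      also have "\<dots> = (A / \<Lambda>) * exp (\<delta> * y)"
        by (simp add: mult.assoc algebra_simps flip: exp_add)
      finally show ?thesis .
    qed
    then show "\<exists>C. \<forall>y\<ge>0. norm (h (\<i> * of_real y)) \<le> C * exp (\<delta> * y)" by blast
  next
    fix x :: real
    have "\<epsilon> * \<bar>x\<bar> + C = \<epsilon> * (\<bar>x\<bar> + \<Lambda>)" using \<Lambda> by (simp add: algebra_simps)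
    also have "\<dots> \<le> \<epsilon> * (2 * norm (of_real x + \<i> * of_real \<Lambda>))"
      using abs_Re_le_cmod[of "of_real x + \<i> * of_real \<Lambda>"]
        abs_Im_le_cmod[of "of_real x + \<i> * of_real \<Lambda>"] \<epsilon> by (intro mult_left_mono) auto
    finally have "norm (f (of_real x)) \<le> 2 * \<epsilon> * norm (of_real x + \<i> * of_real \<Lambda>)"
      using bd[of x] by simp
    moreover have "norm (of_real x + \<i> * of_real \<Lambda>) > 0"
      using order.strict_trans2[OF \<Lambda>(1) den[of "of_real x"]] by simp
    ultimately show "norm (h (of_real x)) \<le> 2 * \<epsilon>"
      unfolding nh by (simp only: pos_divide_le_eq Im_complex_of_real) simp
  qed (use \<epsilon> z in auto)
  moreover have "norm (z + \<i> * of_real \<Lambda>) > 0" using den[OF z] \<Lambda> by linarith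
  ultimately have "norm (f z) * exp (- \<sigma> * Im z) \<le> 2 * \<epsilon> * norm (z + \<i> * of_real \<Lambda>)"
    unfolding nh by (simp add: field_simps)
  also have "\<dots> \<le> 2 * \<epsilon> * (norm z + \<Lambda>)"
    using norm_triangle_ineq[of z "\<i> * of_real \<Lambda>"] \<Lambda> \<epsilon> by (intro mult_left_mono) (auto simp: norm_mult)
  also have "\<dots> = 2 * (\<epsilon> * norm z + C)" using \<Lambda> by (simp add: algebra_simps)
  finally show ?thesis by (simp add: exp_minus field_simps)
qed

lemma sublinear_classI:
  assumes f: "f \<in> exp_class \<sigma>" and \<sigma>: "\<sigma> \<ge> 0"
    and bd: "\<And>\<epsilon>. \<epsilon> > 0 \<Longrightarrow> \<exists>C. \<forall>x. norm (f (of_real x)) \<le> \<epsilon> * \<bar>x\<bar> + C"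
  shows "f \<in> sublinear_class \<sigma>"
proof -
  have hol: "f holomorphic_on UNIV" using f by (simp add: exp_class_def exponential_type_def)
  have "\<exists>C. \<forall>z. norm (f z) \<le> (\<epsilon> * norm z + C) * exp (\<sigma> * \<bar>Im z\<bar>)" if "\<epsilon> > 0" for \<epsilon>
  proof -
    have "\<epsilon> / 2 > 0" using that by simp
    then obtain C0 where C0: "\<And>x. norm (f (of_real x)) \<le> \<epsilon> / 2 * \<bar>x\<bar> + C0"
      using bd by blast
    define C where "C = max C0 1"
    have C: "C > 0" "\<And>x. norm (f (of_real x)) \<le> \<epsilon> / 2 * \<bar>x\<bar> + C"
      using C0 by (auto simp: C_def) (smt (verit) C0)
    have "norm (f z) \<le> 2 * (\<epsilon> / 2 * norm z + C) * exp (\<sigma> * \<bar>Im z\<bar>)" for z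
    proof (cases "Im z \<ge> 0")
      case True
      have "norm (f z) \<le> 2 * (\<epsilon> / 2 * norm z + C) * exp (\<sigma> * Im z)"
        using that by (intro upper_half_plane_estimate hol exp_class_growth[OF f] \<sigma> C True) auto
      then show ?thesis using True by simp
    next
      case False
      have "norm ((\<lambda>z. f (- z)) (- z)) \<le> 2 * (\<epsilon> / 2 * norm (- z) + C) * exp (\<sigma> * Im (- z))"
      proof (rule upper_half_plane_estimate)
        have "(f \<circ> (\<lambda>z. - z)) holomorphic_on UNIV"
          by (rule holomorphic_on_compose_gen[OF _ hol]) (auto intro!: holomorphic_intros)
        then show "(\<lambda>z. f (- z)) holomorphic_on UNIV" by (simp add: o_def)
        show "\<exists>A>0. \<forall>z. norm (f (- z)) \<le> A * exp ((\<sigma> + \<delta>) * norm z)" if "\<delta> > 0" for \<delta>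
          using exp_class_growth[OF f that] by (metis norm_minus_cancel)
        show "norm (f (- of_real x)) \<le> \<epsilon> / 2 * \<bar>x\<bar> + C" for x
          using C(2)[of "- x"] by simp
      qed (use that C \<sigma> False in auto)
      then show ?thesis using False by simp
    qed
    then show ?thesis by (intro exI[of _ "2 * C"]) (auto simp: algebra_simps)
  qed
  then show ?thesis using hol by (auto simp: sublinear_class_def)
qed

lemma sublinear_class_holomorphic: "f \<in> sublinear_class \<sigma> \<Longrightarrow> f holomorphic_on A"
  by (auto simp: sublinear_class_def intro: holomorphic_on_subset)

lemma sublinear_class_add:
  assumes "f \<in> sublinear_class \<sigma>" "g \<in> sublinear_class \<sigma>"
  shows "(\<lambda>z. f z + g z) \<in> sublinear_class \<sigma>"
proof -
  have "\<exists>C. \<forall>z. norm (f z + g z) \<le> (\<epsilon> * norm z + C) * exp (\<sigma> * \<bar>Im z\<bar>)" if "\<epsilon> > 0" for \<epsilon>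
  proof -
    have "\<epsilon> / 2 > 0" using that by simp
    then obtain C D where
      C: "\<And>z. norm (f z) \<le> (\<epsilon> / 2 * norm z + C) * exp (\<sigma> * \<bar>Im z\<bar>)" and
      D: "\<And>z. norm (g z) \<le> (\<epsilon> / 2 * norm z + D) * exp (\<sigma> * \<bar>Im z\<bar>)"
      using assms unfolding sublinear_class_def by blast
    have "norm (f z + g z) \<le> (\<epsilon> * norm z + (C + D)) * exp (\<sigma> * \<bar>Im z\<bar>)" for z
      using norm_triangle_ineq[of "f z" "g z"] C[of z] D[of z] by (simp add: algebra_simps)
    then show ?thesis by blast
  qed
  then show ?thesis
    using assms by (auto simp: sublinear_class_def intro!: holomorphic_intros)
qed

lemma sublinear_class_mult_left:
  assumes "f \<in> sublinear_class \<sigma>"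
  shows "(\<lambda>z. c * f z) \<in> sublinear_class \<sigma>"
proof -
  have "\<exists>C. \<forall>z. norm (c * f z) \<le> (\<epsilon> * norm z + C) * exp (\<sigma> * \<bar>Im z\<bar>)" if "\<epsilon> > 0" for \<epsilon>
  proof -
    define \<eta> where "\<eta> = \<epsilon> / (norm c + 1)"
    have c: "norm c + 1 > 0" by (smt (verit) norm_ge_zero)
    then have "\<eta> > 0" using that by (simp add: \<eta>_def)
    then obtain C where C: "\<And>z. norm (f z) \<le> (\<eta> * norm z + C) * exp (\<sigma> * \<bar>Im z\<bar>)"
      using assms unfolding sublinear_class_def by blast
    have "norm (c * f z) \<le> (\<epsilon> * norm z + (norm c + 1) * C) * exp (\<sigma> * \<bar>Im z\<bar>)" for z
    proof -
      have "norm (c * f z) \<le> (norm c + 1) * norm (f z)"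
        by (simp add: norm_mult mult_right_mono)
      also have "\<dots> \<le> (norm c + 1) * ((\<eta> * norm z + C) * exp (\<sigma> * \<bar>Im z\<bar>))"
        using c by (intro mult_left_mono C) auto
      also have "\<dots> = (\<epsilon> * norm z + (norm c + 1) * C) * exp (\<sigma> * \<bar>Im z\<bar>)"
        using c by (simp add: \<eta>_def field_simps)
      finally show ?thesis .
    qed
    then show ?thesis by blast
  qed
  then show ?thesis
    using assms by (auto simp: sublinear_class_def intro!: holomorphic_intros)
qed

lemma sublinear_class_rescale:
  assumes f: "f \<in> sublinear_class \<sigma>" and \<sigma>: "\<sigma> > 0"
  shows "(\<lambda>z. f ((z - of_real a) / of_real \<sigma>)) \<in> sublinear_class 1"
proof -
  have hol: "f holomorphic_on UNIV" using f by (rule sublinear_class_holomorphic)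
  have "(f \<circ> (\<lambda>z. (z - of_real a) / of_real \<sigma>)) holomorphic_on UNIV"
    using \<sigma> by (intro holomorphic_on_compose_gen[OF _ hol]) (auto intro!: holomorphic_intros)
  moreover have "\<exists>C. \<forall>z. norm (f ((z - of_real a) / of_real \<sigma>)) \<le> (\<epsilon> * norm z + C) * exp (1 * \<bar>Im z\<bar>)"
    if "\<epsilon> > 0" for \<epsilon>
  proof -
    have "\<epsilon> * \<sigma> > 0" using that \<sigma> by simp
    then obtain C where C: "\<And>z. norm (f z) \<le> (\<epsilon> * \<sigma> * norm z + C) * exp (\<sigma> * \<bar>Im z\<bar>)"
      using f unfolding sublinear_class_def by blast
    have "norm (f ((z - of_real a) / of_real \<sigma>)) \<le> (\<epsilon> * norm z + (\<epsilon> * \<bar>a\<bar> + C)) * exp (1 * \<bar>Im z\<bar>)" for z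
    proof -
      have "norm (f ((z - of_real a) / of_real \<sigma>)) \<le> (\<epsilon> * norm (z - of_real a) + C) * exp (1 * \<bar>Im z\<bar>)"
        using C[of "(z - of_real a) / of_real \<sigma>"] \<sigma> by (simp add: norm_divide)
      also have "\<dots> \<le> (\<epsilon> * (norm z + \<bar>a\<bar>) + C) * exp (1 * \<bar>Im z\<bar>)"
        using that norm_triangle_ineq4[of z "of_real a"]
        by (intro mult_right_mono add_right_mono mult_left_mono) auto
      finally show ?thesis by (simp add: algebra_simps)
    qed
    then show ?thesis by blast
  qed
  ultimately show ?thesis by (auto simp: sublinear_class_def o_def)
qed

lemma norm_cos_le: "norm (cos z) \<le> exp \<bar>Im z\<bar>" for z :: complex
proof -
  have "norm (exp (\<i> * z) + exp (- (\<i> * z))) \<le> exp (- Im z) + exp (Im z)"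
    by (rule norm_triangle_le) simp
  also have "\<dots> \<le> exp \<bar>Im z\<bar> + exp \<bar>Im z\<bar>" by (intro add_mono) auto
  finally show ?thesis by (simp add: cos_exp_eq norm_divide)
qed

lemma cos_sublinear_class: "(\<lambda>z. cos (of_real \<sigma> * z + of_real a)) \<in> sublinear_class \<sigma>"
  if \<sigma>: "\<sigma> \<ge> 0"
proof -
  have "norm (cos (of_real \<sigma> * z + of_real a)) \<le> (\<epsilon> * norm z + 1) * exp (\<sigma> * \<bar>Im z\<bar>)"
    if "\<epsilon> > 0" for \<epsilon> z
  proof -
    have "norm (cos (of_real \<sigma> * z + of_real a)) \<le> 1 * exp (\<sigma> * \<bar>Im z\<bar>)"
      using norm_cos_le[of "of_real \<sigma> * z + of_real a"] \<sigma> by (simp add: abs_mult)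
    also have "\<dots> \<le> (\<epsilon> * norm z + 1) * exp (\<sigma> * \<bar>Im z\<bar>)"
      using that by (intro mult_right_mono) auto
    finally show ?thesis .
  qed
  then show ?thesis by (auto simp: sublinear_class_def intro!: holomorphic_intros)
qed

lemma smallo_imp_affine_bound:
  fixes f :: "real \<Rightarrow> complex"
  assumes top: "f \<in> o[at_top](\<lambda>x. of_real x)" and bot: "f \<in> o[at_bot](\<lambda>x. of_real x)"
    and cont: "continuous_on UNIV f" and \<epsilon>: "\<epsilon> > 0"
  shows "\<exists>C. \<forall>x. norm (f x) \<le> \<epsilon> * \<bar>x\<bar> + C"
proof -
  obtain a where a: "\<And>x. x \<ge> a \<Longrightarrow> norm (f x) \<le> \<epsilon> * \<bar>x\<bar>"
    using landau_o.smallD[OF top \<epsilon>] by (auto simp: eventually_at_top_linorder)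
  obtain b where b: "\<And>x. x \<le> b \<Longrightarrow> norm (f x) \<le> \<epsilon> * \<bar>x\<bar>"
    using landau_o.smallD[OF bot \<epsilon>] by (auto simp: eventually_at_bot_linorder)
  have "compact (f ` {b..a})"
    using cont by (intro compact_continuous_image) (auto intro: continuous_on_subset)
  then obtain C where C: "C > 0" "\<And>x. x \<in> {b..a} \<Longrightarrow> norm (f x) \<le> C"
    by (auto dest!: compact_imp_bounded simp: bounded_pos)
  have "norm (f x) \<le> \<epsilon> * \<bar>x\<bar> + C" for x
  proof -
    consider "x \<ge> a" | "x \<le> b" | "x \<in> {b..a}" by fastforce
    then show ?thesis
    proof cases
      case 3
      have "0 \<le> \<epsilon> * \<bar>x\<bar>" using \<epsilon> by simp
      then show ?thesis using C(2)[OF 3] by linarith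
    qed (use a[of x] b[of x] C(1) in linarith)+
  qed
  then show ?thesis by blast
qed

section \<open>An interpolation formula at the zeros of the sine\<close>

text \<open>Write \<open>R\<close> for the radius and \<open>z = x + \<i> * y\<close>. Away from the real axis \<open>\<bar>sin z\<bar>\<close> is comparable to
  \<open>exp \<bar>y\<bar>\<close>. If \<open>\<bar>y\<bar> < 1\<close>, then \<open>R - \<bar>x\<bar> \<le> y\<^sup>2 / R \<le> 2 / \<pi> \<le> \<pi> / 4\<close>, and since \<open>2 * R\<close> is an odd
  multiple of \<open>\<pi>\<close>, this gives \<open>cos (2 * x) \<le> 0\<close>.\<close>

lemma norm_sin_ge_on_circle:
  fixes z :: complex
  assumes z: "norm z = (real N + 1/2) * pi"
  shows "norm (sin z) \<ge> exp \<bar>Im z\<bar> / 4"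
proof -
  define x y where "x = Re z" and "y = Im z"
  have exp_abs: "exp (2 * y) + exp (- (2 * y)) \<ge> exp (2 * \<bar>y\<bar>)"
    by (cases "y \<ge> 0") auto
  have "exp (2 * y) + exp (- (2 * y)) - 2 * cos (2 * x) \<ge> exp (2 * \<bar>y\<bar>) / 2"
  proof (cases "\<bar>y\<bar> \<ge> 1")
    case True
    have "(2::real) * 2 \<le> exp 1 * exp 1"
      using exp_ge_add_one_self[of 1] by (intro mult_mono) auto
    also have "\<dots> = exp (2::real)" by (simp flip: exp_add)
    also have "\<dots> \<le> exp (2 * \<bar>y\<bar>)" using True by simp
    finally show ?thesis using exp_abs cos_le_one[of "2 * x"] by linarith
  next
    case False
    define R where "R = (real N + 1/2) * pi"
    have R: "R \<ge> pi / 2" by (simp add: R_def field_simps)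
    have xyR: "x\<^sup>2 + y\<^sup>2 = R\<^sup>2" using z by (simp add: R_def x_def y_def flip: cmod_power2)
    have xR: "\<bar>x\<bar> \<le> R" using z abs_Re_le_cmod[of z] by (simp add: R_def x_def)
    define t where "t = R - \<bar>x\<bar>"
    have t0: "t \<ge> 0" using xR by (simp add: t_def)
    have "R * t \<le> (R + \<bar>x\<bar>) * t" using t0 by (intro mult_right_mono) auto
    also have "\<dots> = R\<^sup>2 - x\<^sup>2" by (simp add: t_def power2_eq_square algebra_simps)
    also have "\<dots> = y\<^sup>2" using xyR by simp
    also have "\<dots> \<le> 1" using False by (simp add: abs_square_le_1)
    finally have "R * t \<le> 1" .
    moreover have "pi / 2 * t \<le> R * t" using R t0 by (intro mult_right_mono)
    moreover have "3 * 3 \<le> pi * pi" using pi_gt3 by (intro mult_mono) auto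
    ultimately have "pi * t \<le> pi * (pi / 4)" by (simp only: times_divide_eq_left times_divide_eq_right)
    then have t1: "t \<le> pi / 4" using pi_gt_zero by (simp only: mult_le_cancel_left_pos)
    have "cos (2 * x) = cos (2 * \<bar>x\<bar>)" by (cases "x \<ge> 0") auto
    also have "2 * \<bar>x\<bar> = (pi - 2 * t) + 2 * pi * real N" by (simp add: t_def R_def algebra_simps)
    also have "cos \<dots> = cos (pi - 2 * t)"
      using cos.plus_of_nat[of "pi - 2 * t" N] by (simp add: mult.commute)
    also have "\<dots> = - cos (2 * t)" by (simp add: cos_diff)
    also have "\<dots> \<le> 0" using t0 t1 cos_ge_zero[of "2 * t"] by simp
    finally show ?thesis using exp_abs exp_gt_zero[of "2 * \<bar>y\<bar>"] by linarith
  qed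
  then have "(norm (sin z))\<^sup>2 \<ge> exp (2 * \<bar>y\<bar>) / 8"
    by (simp add: norm_sin_squared x_def y_def exp_minus)
  also have "exp (2 * \<bar>y\<bar>) / 8 \<ge> exp (2 * \<bar>y\<bar>) / 16" by simp
  also have "exp (2 * \<bar>y\<bar>) / 16 = (exp \<bar>y\<bar> / 4)\<^sup>2"
    by (simp add: power_divide exp_double)
  finally show ?thesis
    using power2_le_imp_le[of "exp \<bar>y\<bar> / 4" "norm (sin z)"] by (simp add: y_def)
qed

lemma sin_zero_in_disc:
  fixes z :: complex
  assumes "sin z = 0" "norm z < (real N + 1) * pi"
  shows "z \<in> (\<lambda>k. of_real (of_int k * pi)) ` {- int N..int N}"
proof -
  obtain k :: int where k: "z = of_real (of_int k * pi)"
    using assms(1) unfolding sin_eq_0 by blast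
  have "\<bar>of_int k\<bar> * pi < (real N + 1) * pi"
    using assms(2) unfolding k norm_of_real by (simp add: abs_mult)
  then have "\<bar>real_of_int k\<bar> < real N + 1" by (simp only: mult_less_cancel_right_pos pi_gt_zero)
  then have "k \<in> {- int N..int N}" by auto
  then show ?thesis using k by blast
qed

lemma residue_over_sin:
  assumes q: "open A" "q holomorphic_on A" "p \<in> A" and p: "sin p = 0"
  shows "residue (\<lambda>z. q z / sin z) p = q p / cos p"
proof -
  have cp: "cos p \<noteq> 0" using p sin_cos_squared_add[of p] by auto
  have lim: "((\<lambda>z. sin z / (z - p)) \<longlongrightarrow> cos p) (at p)"
    using DERIV_sin[of p] p by (simp add: has_field_derivative_iff)
  then have "eventually (\<lambda>z. sin z / (z - p) \<noteq> 0) (at p)"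
    using cp by (rule tendsto_imp_eventually_ne)
  then obtain r where r: "r > 0" "\<And>z. z \<noteq> p \<Longrightarrow> dist z p < r \<Longrightarrow> sin z \<noteq> 0"
    by (auto simp: eventually_at)
  define s where "s = A \<inter> ball p r"
  show ?thesis
  proof (rule residue_simple')
  show "open s" "p \<in> s" using q r by (auto simp: s_def)
  show "(\<lambda>z. q z / sin z) holomorphic_on s - {p}"
    using r by (auto intro!: holomorphic_intros holomorphic_on_subset[OF q(2)] simp: s_def dist_commute)
  have "(q \<longlongrightarrow> q p) (at p)"
    using q by (metis continuous_on_eq_continuous_at holomorphic_on_imp_continuous_on isContD)
  then have "((\<lambda>z. q z / (sin z / (z - p))) \<longlongrightarrow> q p / cos p) (at p)"
    by (intro tendsto_divide lim cp)
  then show "((\<lambda>z. q z / sin z * (z - p)) \<longlongrightarrow> q p / cos p) (at p)" by simp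
  qed
qed

text \<open>The right-hand side is \<open>-(g / sin)' w\<close>. Up to sign it is the residue at \<open>w\<close> of
  \<open>g z / (sin z * (z - w)\<^sup>2)\<close>, while the summands are the residues at the zeros of the sine. Since \<open>g / sin\<close> is \<open>o(R)\<close> on
  the circles of radius \<open>R = (N + 1/2) * \<pi>\<close>, the integrals over them tend to 0. The sum is taken
  symmetrically because the growth assumption on \<open>g\<close> does not give absolute convergence.\<close>
theorem sine_interpolation_of_derivative:
  fixes g :: "complex \<Rightarrow> complex"
  assumes g: "g \<in> sublinear_class 1" and w: "sin w \<noteq> 0"
  shows "(\<lambda>N. \<Sum>k\<in>{- int N..int N}. g (of_real (of_int k * pi)) /
            (cos (of_real (of_int k * pi)) * (w - of_real (of_int k * pi))\<^sup>2))
         \<longlonglongrightarrow> (g w * cos w - deriv g w * sin w) / (sin w)\<^sup>2"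
    (is "(\<lambda>N. \<Sum>k\<in>?K N. ?t k) \<longlonglongrightarrow> ?L")
proof (rule LIMSEQ_I)
  fix e :: real assume e: "e > 0"
  have hol: "g holomorphic_on A" for A using g by (rule sublinear_class_holomorphic)
  \<comment> \<open>The contour integral below turns out to be at most \<open>32 * \<epsilon>\<close>.\<close>
  define \<epsilon> where "\<epsilon> = e / 64"
  have \<epsilon>: "\<epsilon> > 0" using e by (simp add: \<epsilon>_def)
  obtain C where C: "\<And>z. norm (g z) \<le> (\<epsilon> * norm z + C) * exp (1 * \<bar>Im z\<bar>)"
    using g \<epsilon> unfolding sublinear_class_def by blast
  define pnt where "pnt = (\<lambda>k::int. complex_of_real (of_int k * pi))"
  have sin_pnt: "sin (pnt k) = 0" for k unfolding pnt_def sin_eq_0 by blast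
  define F where "F = (\<lambda>z. g z / (sin z * (z - w)\<^sup>2))"
  \<comment> \<open>For \<open>R > 2 * norm w\<close> the distance from the contour to \<open>w\<close> is at least \<open>R / 2\<close>, and for
     \<open>R > C / \<epsilon>\<close> the constant \<open>C\<close> is absorbed by \<open>\<epsilon> * R\<close>.\<close>
  obtain N0 where N0: "real N0 > max (2 * norm w) (C / \<epsilon>)" using reals_Archimedean2 by blast
  have "norm ((\<Sum>k\<in>?K N. ?t k) - ?L) < e" if N: "N \<ge> N0" for N
  proof -
    define R where "R = (real N + 1/2) * pi"
    have "real N * 1 \<le> real N * pi" using pi_gt3 by (intro mult_left_mono) auto
    then have "R > real N" unfolding R_def using pi_gt_zero unfolding distrib_right by linarith
    moreover have "real N \<ge> real N0" using N by simp
    ultimately have R: "R > 2 * norm w" "R > C / \<epsilon>" "R > 0" "R > norm w"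
      using N0 norm_ge_zero[of w] by linarith+
    define P where "P = pnt ` ?K N"
    \<comment> \<open>The radius \<open>(N + 1) * \<pi>\<close> exceeds \<open>R\<close> but admits no zero of the sine beyond \<open>\<plusminus>N * \<pi>\<close>.\<close>
    define S where "S = ball (0::complex) ((real N + 1) * pi)"
    have Pzero: "sin z \<noteq> 0" if "z \<in> S - P" for z
      using that sin_zero_in_disc[of z N] by (auto simp: S_def P_def pnt_def)
    have wP: "w \<notin> P" using w sin_pnt by (auto simp: P_def)
    have PR: "norm z < R" if "z \<in> P" for z
    proof -
      obtain k where k: "z = pnt k" "\<bar>k\<bar> \<le> int N" using \<open>z \<in> P\<close> by (auto simp: P_def)
      then have "norm z = \<bar>of_int k\<bar> * pi" by (simp add: pnt_def norm_mult)
      also have "\<dots> \<le> real N * pi" using k(2) by (intro mult_right_mono) auto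
      also have "\<dots> < R" by (simp add: R_def)
      finally show ?thesis .
    qed
    have "R < (real N + 1) * pi" unfolding R_def by (intro mult_strict_right_mono) auto
    then have RS: "cball 0 R \<subseteq> S" by (auto simp: S_def)
    have holF: "F holomorphic_on S - insert w P"
      unfolding F_def using Pzero by (intro holomorphic_intros hol) auto
    have circ: "path_image (circlepath 0 R) \<subseteq> S - insert w P"
      using RS R PR by (force simp: sphere_def)
    have "contour_integral (circlepath 0 R) F
        = 2 * pi * \<i> * (\<Sum>z\<in>insert w P. winding_number (circlepath 0 R) z * residue F z)"
    proof (rule Residue_theorem[where S = S])
      show "\<forall>z. z \<notin> S \<longrightarrow> winding_number (circlepath 0 R) z = 0"
        using RS R(3) by (intro allI impI winding_number_zero_outside[of _ "cball 0 R"]) auto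
    qed (use holF circ in \<open>auto simp: S_def P_def\<close>)
    also have "(\<Sum>z\<in>insert w P. winding_number (circlepath 0 R) z * residue F z)
        = (\<Sum>z\<in>insert w P. residue F z)"
      using PR R by (intro sum.cong refl) (auto simp: winding_number_circlepath)
    also have "\<dots> = residue F w + (\<Sum>z\<in>P. residue F z)"
      using wP by (subst sum.insert) (auto simp: P_def)
    also have "(\<Sum>z\<in>P. residue F z) = (\<Sum>k\<in>?K N. residue F (pnt k))"
      unfolding P_def by (subst sum.reindex) (auto simp: inj_on_def pnt_def)
    also have "\<dots> = (\<Sum>k\<in>?K N. ?t k)"
    proof (rule sum.cong[OF refl])
      fix k
      have "pnt k \<noteq> w" using w sin_pnt by metis
      then have "residue (\<lambda>z. (g z / (z - w)\<^sup>2) / sin z) (pnt k) = (g (pnt k) / (pnt k - w)\<^sup>2) / cos (pnt k)"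
        by (intro residue_over_sin[where A = "- {w}"] holomorphic_intros hol) (auto simp: sin_pnt)
      then show "residue F (pnt k) = ?t k"
        by (simp add: F_def pnt_def mult.commute power2_commute)
    qed
    also have "residue F w = - ?L"
    proof -
      have op: "open {z::complex. sin z \<noteq> 0}" by (intro open_Collect_neq continuous_intros)
      have "residue (\<lambda>z. (g z / sin z) / (z - w) ^ Suc 1) w = (deriv ^^ 1) (\<lambda>z. g z / sin z) w / fact 1"
        using w by (intro residue_holomorphic_over_power[OF op] holomorphic_intros hol) auto
      also have "(deriv ^^ 1) (\<lambda>z. g z / sin z) w = (deriv g w * sin w - g w * cos w) / (sin w)\<^sup>2"
        using w hol[of UNIV]
        by (auto intro!: DERIV_imp_deriv derivative_eq_intros holomorphic_derivI[of g UNIV] simp: power2_eq_square)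
      finally show ?thesis by (simp add: F_def power2_eq_square minus_divide_left)
    qed
    finally have ci: "contour_integral (circlepath 0 R) F = 2 * pi * \<i> * ((\<Sum>k\<in>?K N. ?t k) - ?L)"
      by simp
    define B where "B = 4 * (\<epsilon> * R + C) / (R / 2)\<^sup>2"
    have CR: "0 < \<epsilon> * R + C" "C < \<epsilon> * R"
    proof -
      show "C < \<epsilon> * R" using R(2) \<epsilon> by (simp add: field_simps)
      have "0 \<le> C" using order_trans[OF norm_ge_zero C[of 0]] by simp
      then show "0 < \<epsilon> * R + C" using \<epsilon> R by (simp add: add_pos_nonneg)
    qed
    have "norm (contour_integral (circlepath 0 R) F) \<le> B * (2 * pi * R)"
    proof (rule has_contour_integral_bound_circlepath)
      have "open (S - insert w P)" by (auto simp: S_def P_def intro!: open_Diff finite_imp_closed)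
      then show "(F has_contour_integral contour_integral (circlepath 0 R) F) (circlepath 0 R)"
        using holF circ
        by (intro has_contour_integral_integral contour_integrable_holomorphic_simple) auto
      show "0 \<le> B" using CR by (simp add: B_def)
      fix z :: complex assume "norm (z - 0) = R"
      then have z: "norm z = R" by simp
      have "norm (g z) / norm (sin z) \<le> ((\<epsilon> * R + C) * exp \<bar>Im z\<bar>) / (exp \<bar>Im z\<bar> / 4)"
        using C[of z] CR z norm_sin_ge_on_circle[of z N] by (intro frac_le) (auto simp: R_def)
      then have "norm (g z) / norm (sin z) \<le> 4 * (\<epsilon> * R + C)" by simp
      moreover have "R / 2 \<le> norm (z - w)" using norm_triangle_ineq2[of z w] z R by simp
      ultimately have "(norm (g z) / norm (sin z)) / (norm (z - w))\<^sup>2 \<le> 4 * (\<epsilon> * R + C) / (R / 2)\<^sup>2"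
        using R CR by (intro frac_le power_mono) auto
      then show "norm (F z) \<le> B"
        by (simp add: F_def B_def norm_divide norm_mult norm_power)
    qed (use R in auto)
    then have "norm ((\<Sum>k\<in>?K N. ?t k) - ?L) \<le> B * R"
      unfolding ci by (simp add: norm_mult)
    also have "\<dots> = 16 * (\<epsilon> * R + C) / R" using R by (simp add: B_def power2_eq_square field_simps)
    also have "\<dots> < 16 * (\<epsilon> * R + \<epsilon> * R) / R" using R(3) CR(2) by (intro divide_strict_right_mono mult_strict_left_mono add_strict_left_mono) simp_all
    also have "\<dots> = 32 * \<epsilon>" using R by simp
    finally show ?thesis using e by (simp add: \<epsilon>_def)
  qed
  then show "\<exists>N0. \<forall>N\<ge>N0. norm ((\<Sum>k\<in>?K N. ?t k) - ?L) < e" by blast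
qed

text \<open>All summands of the interpolation formula vanish, so \<open>g / sin\<close> has derivative zero off the zeros of
  the sine, a connected set.\<close>
lemma sublinear_class_vanishing_on_sine_zeros:
  fixes g :: "complex \<Rightarrow> complex"
  assumes g: "g \<in> sublinear_class 1" and zero: "\<And>k::int. g (of_real (of_int k * pi)) = 0"
  shows "\<exists>c. \<forall>z. g z = c * sin z"
proof -
  have hol: "g holomorphic_on UNIV" using g by (rule sublinear_class_holomorphic)
  define T where "T = {z::complex. sin z \<noteq> 0}"
  have oT: "open T" unfolding T_def by (intro open_Collect_neq continuous_intros)
  have T: "T = UNIV - range (\<lambda>k::int. of_real (of_int k * pi))"
    by (auto simp: T_def sin_eq_0)
  have "connected T" unfolding T by (rule connected_open_diff_countable) auto
  moreover have "((\<lambda>z. g z / sin z) has_field_derivative 0) (at w)" if "w \<in> T" for w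
  proof -
    have sw: "sin w \<noteq> 0" using that by (simp add: T_def)
    have "(\<lambda>N::nat. 0) \<longlonglongrightarrow> (g w * cos w - deriv g w * sin w) / (sin w)\<^sup>2"
      using sine_interpolation_of_derivative[OF g sw] by (simp only: zero) simp
    then have "(g w * cos w - deriv g w * sin w) / (sin w)\<^sup>2 = 0"
      by (simp add: LIMSEQ_const_iff)
    then have "deriv g w * sin w - g w * cos w = 0" using sw by simp
    then show ?thesis using sw
      by (auto intro!: derivative_eq_intros holomorphic_derivI[OF hol])
  qed
  ultimately have "(\<lambda>z. g z / sin z) constant_on T"
    using oT by (intro has_field_derivative_0_imp_constant_on)
  then obtain c where c: "\<And>z. z \<in> T \<Longrightarrow> g z / sin z = c"
    by (auto simp: constant_on_def)
  have "g z = c * sin z" for z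
    using c[of z] zero by (cases "z \<in> T") (auto simp: T_def sin_eq_0 field_simps)
  then show ?thesis by blast
qed

section \<open>The quadratic form attached to the pair\<close>

lemma quadratic_form_on_circle:
  fixes a b e :: real
  assumes nonneg: "\<And>\<phi>. a * (cos \<phi>)\<^sup>2 + b * cos \<phi> * sin \<phi> + e * (sin \<phi>)\<^sup>2 \<ge> 0"
  shows quadratic_form_discriminant: "b\<^sup>2 \<le> 4 * a * e"
    and quadratic_form_isotropic: "b\<^sup>2 = 4 * a * e \<Longrightarrow> a \<noteq> 0 \<Longrightarrow>
      \<exists>\<phi>. sin \<phi> \<noteq> 0 \<and> a * (cos \<phi>)\<^sup>2 + b * cos \<phi> * sin \<phi> + e * (sin \<phi>)\<^sup>2 = 0"
proof -
  have polar: "a * s\<^sup>2 + b * s * t + e * t\<^sup>2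
      = r\<^sup>2 * (a * (cos \<phi>)\<^sup>2 + b * cos \<phi> * sin \<phi> + e * (sin \<phi>)\<^sup>2)"
    if "s = r * cos \<phi>" "t = r * sin \<phi>" for s t r \<phi>
    using that by (simp add: power2_eq_square algebra_simps)
  have form: "a * s\<^sup>2 + b * s * t + e * t\<^sup>2 \<ge> 0" for s t
    using polar_Ex[of s t] polar nonneg by (metis mult_nonneg_nonneg zero_le_power2)
  have a: "a \<ge> 0" using nonneg[of 0] by simp
  \<comment> \<open>Clearing denominators at the critical point \<open>s / t = - b / (2 * a)\<close> of the form.\<close>
  have vertex: "a * (- b)\<^sup>2 + b * (- b) * (2 * a) + e * (2 * a)\<^sup>2 = a * (4 * a * e - b\<^sup>2)"
    by (simp add: power2_eq_square algebra_simps)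
  show "b\<^sup>2 \<le> 4 * a * e"
  proof (cases "a = 0")
    case True
    have "b = 0"
    proof (rule ccontr)
      assume b: "b \<noteq> 0"
      show False using form[of "- (e + 1) / b" 1] b True by simp
    qed
    then show ?thesis using True by simp
  next
    case False
    then show ?thesis using form[of "- b" "2 * a"] a unfolding vertex by (simp add: zero_le_mult_iff)
  qed
  assume eq: "b\<^sup>2 = 4 * a * e" and a0: "a \<noteq> 0"
  obtain r \<phi> where r: "- b = r * cos \<phi>" "2 * a = r * sin \<phi>" using polar_Ex by blast
  then have "r \<noteq> 0" "sin \<phi> \<noteq> 0" using a0 by auto
  moreover have "r\<^sup>2 * (a * (cos \<phi>)\<^sup>2 + b * cos \<phi> * sin \<phi> + e * (sin \<phi>)\<^sup>2) = 0"
    using polar[OF r] vertex eq by simp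
  ultimately show "\<exists>\<phi>. sin \<phi> \<noteq> 0 \<and> a * (cos \<phi>)\<^sup>2 + b * cos \<phi> * sin \<phi> + e * (sin \<phi>)\<^sup>2 = 0"
    by auto
qed

lemma axis_has_derivative:
  assumes "f holomorphic_on UNIV"
  shows "(axis f has_real_derivative axis (deriv f) x) (at x)"
proof -
  have "(f has_field_derivative deriv f (of_real x)) (at (of_real x))"
    using assms by (intro holomorphic_derivI) auto
  then have "((\<lambda>x. f (of_real x)) has_vector_derivative deriv f (of_real x)) (at x)"
    by (rule has_vector_derivative_real_field)
  then have "((\<lambda>x. Re (f (of_real x))) has_vector_derivative Re (deriv f (of_real x))) (at x)"
    by (rule bounded_linear.has_vector_derivative[OF bounded_linear_Re])
  then show ?thesis
    by (simp add: has_real_derivative_iff_has_vector_derivative axis_def[abs_def])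
qed

lemma real_on_axis_eq: "real_on_axis f \<Longrightarrow> f (of_real x) = of_real (axis f x)"
  by (simp add: real_on_axis_def axis_def of_real_Re)

lemma sin_int_pi: "sin (of_int k * pi) = 0"
  using sin_zero_iff_int2 by blast

lemma cos_int_pi_sq: "cos (of_int k * pi) * cos (of_int k * pi) = 1"
  using sin_cos_squared_add3[of "of_int k * pi"] unfolding sin_int_pi by (simp only: mult_zero_left add_0_right)

lemma divide_self_inverse:
  fixes u v :: real
  assumes "v * v = 1"
  shows "u / v = v * u"
proof -
  have "v \<noteq> 0" using assms by auto
  then have "u / v = (u * (v * v)) / v" using assms by simp
  then show ?thesis using \<open>v \<noteq> 0\<close> by simp
qed

text \<open>In the comments of this locale \<open>\<theta>\<close> stands for the phase \<open>\<sigma> * x + \<tau>\<close>.\<close>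
locale real_pair =
  fixes \<sigma> \<tau> :: real and P Q :: "complex \<Rightarrow> complex"
  assumes \<sigma>: "\<sigma> > 0"
    and P: "P \<in> sublinear_class \<sigma>" and Q: "Q \<in> sublinear_class \<sigma>"
    and P_real: "real_on_axis P" and Q_real: "real_on_axis Q"
    and E_nonneg: "\<And>x. E_fun P Q \<sigma> \<tau> x \<ge> 0"
begin

text \<open>The projection of the curve \<open>(P, Q)\<close> to the direction \<open>\<alpha>\<close>.\<close>
definition slice :: "real \<Rightarrow> complex \<Rightarrow> complex" where
  "slice \<alpha> z = of_real (cos \<alpha>) * P z + of_real (sin \<alpha>) * Q z"

text \<open>The points where \<open>\<theta> = k * \<pi> + \<alpha>\<close>. There \<open>(cos \<theta>, sin \<theta>)\<close> is \<open>\<plusminus>(cos \<alpha>, sin \<alpha>)\<close>, so that the sign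
  condition on \<open>E\<close> becomes a condition on the values of the slice.\<close>
definition node :: "real \<Rightarrow> int \<Rightarrow> real" where
  "node \<alpha> k = (of_int k * pi + \<alpha> - \<tau>) / \<sigma>"

text \<open>Up to the factor \<open>- sin\<^sup>2 (\<theta> - \<alpha>)\<close>, the derivative of the quotient of the slice by \<open>sin (\<theta> - \<alpha>)\<close>.
  For fixed \<open>x\<close> it is a quadratic form in \<open>(cos \<alpha>, sin \<alpha>)\<close>.\<close>
definition slice_form :: "real \<Rightarrow> real \<Rightarrow> real" where
  "slice_form \<alpha> x = \<sigma> * axis (slice \<alpha>) x * cos (\<sigma> * x + \<tau> - \<alpha>)
                    - axis (deriv (slice \<alpha>)) x * sin (\<sigma> * x + \<tau> - \<alpha>)"

lemma P_holomorphic: "P holomorphic_on A" and Q_holomorphic: "Q holomorphic_on A"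
  using P Q by (auto intro: sublinear_class_holomorphic)

lemma slice_class: "slice \<alpha> \<in> sublinear_class \<sigma>"
  unfolding slice_def[abs_def] by (intro sublinear_class_add sublinear_class_mult_left P Q)

lemma deriv_slice: "deriv (slice \<alpha>) z = of_real (cos \<alpha>) * deriv P z + of_real (sin \<alpha>) * deriv Q z"
  unfolding slice_def[abs_def]
  by (rule DERIV_imp_deriv) (auto intro!: derivative_eq_intros holomorphic_derivI[of _ UNIV] P_holomorphic Q_holomorphic)

lemma axis_slice: "axis (slice \<alpha>) x = cos \<alpha> * axis P x + sin \<alpha> * axis Q x"
  and axis_deriv_slice: "axis (deriv (slice \<alpha>)) x = cos \<alpha> * axis (deriv P) x + sin \<alpha> * axis (deriv Q) x"
  by (simp_all add: axis_def slice_def deriv_slice)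

lemma slice_real: "slice \<alpha> (of_real x) = of_real (axis (slice \<alpha>) x)"
  by (simp add: slice_def axis_slice real_on_axis_eq[OF P_real] real_on_axis_eq[OF Q_real])

lemma phase_at_node: "\<sigma> * node \<alpha> k + \<tau> = of_int k * pi + \<alpha>"
  using \<sigma> by (simp add: node_def)

lemma E_at_node: "E_fun P Q \<sigma> \<tau> (node \<alpha> k) = cos (of_int k * pi) * axis (slice \<alpha>) (node \<alpha> k)"
  unfolding E_fun_def phase_at_node axis_slice by (simp add: cos_add sin_add algebra_simps)

text \<open>The interpolation formula, rescaled so that the zeros of the sine become the nodes. Division by
  \<open>cos (k * \<pi>) = (-1)\<^sup>k\<close> turns the value of the slice at a node into the value of \<open>E\<close>, so all terms
  have the same sign.\<close>
lemma slice_form_interpolation: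
  assumes s: "sin (\<sigma> * x + \<tau> - \<alpha>) \<noteq> 0"
  shows "(\<lambda>N. \<Sum>k\<in>{- int N..int N}. E_fun P Q \<sigma> \<tau> (node \<alpha> k) / (\<sigma> * x + \<tau> - \<alpha> - of_int k * pi)\<^sup>2)
     \<longlonglongrightarrow> slice_form \<alpha> x / (\<sigma> * (sin (\<sigma> * x + \<tau> - \<alpha>))\<^sup>2)"
proof -
  define t where "t = \<sigma> * x + \<tau> - \<alpha>"
  define g where "g = (\<lambda>z. slice \<alpha> ((z - of_real (\<tau> - \<alpha>)) / of_real \<sigma>))"
  have g: "g \<in> sublinear_class 1"
    unfolding g_def by (rule sublinear_class_rescale[OF slice_class \<sigma>])
  have g_real: "g (of_real y) = of_real (axis (slice \<alpha>) ((y - (\<tau> - \<alpha>)) / \<sigma>))" for y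
    using slice_real[of \<alpha> "(y - (\<tau> - \<alpha>)) / \<sigma>"] by (simp add: g_def)
  have pre: "(t - (\<tau> - \<alpha>)) / \<sigma> = x" using \<sigma> by (simp add: t_def)
  have g_node: "g (of_real (of_int k * pi)) = of_real (axis (slice \<alpha>) (node \<alpha> k))" for k
    unfolding g_real by (simp add: node_def algebra_simps)
  have g_deriv: "deriv g (of_real t) = deriv (slice \<alpha>) (of_real x) / of_real \<sigma>"
  proof (rule DERIV_imp_deriv)
    have "((\<lambda>z. (z - of_real (\<tau> - \<alpha>)) / of_real \<sigma>) has_field_derivative 1 / of_real \<sigma>) (at (complex_of_real t))"
      using \<sigma> by (auto intro!: derivative_eq_intros)
    moreover have "(slice \<alpha> has_field_derivative deriv (slice \<alpha>) (of_real x)) (at (of_real x))"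
      by (intro holomorphic_derivI[of _ UNIV] sublinear_class_holomorphic[OF slice_class]) auto
    moreover have "(complex_of_real t - of_real (\<tau> - \<alpha>)) / of_real \<sigma> = of_real x"
      using arg_cong[OF pre, of complex_of_real] by simp
    ultimately show "(g has_field_derivative deriv (slice \<alpha>) (of_real x) / of_real \<sigma>) (at (of_real t))"
      unfolding g_def using DERIV_chain2[where f = "slice \<alpha>" and g = "\<lambda>z. (z - of_real (\<tau> - \<alpha>)) / of_real \<sigma>"
          and x = "complex_of_real t" and s = UNIV] by fastforce
  qed
  have "sin (complex_of_real t) \<noteq> 0"
    using s unfolding t_def sin_of_real of_real_eq_0_iff .
  from tendsto_Re[OF sine_interpolation_of_derivative[OF g this]]
  have lim: "(\<lambda>N. \<Sum>k\<in>{- int N..int N}. Re (g (of_real (of_int k * pi)) /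
            (cos (of_real (of_int k * pi)) * (of_real t - of_real (of_int k * pi))\<^sup>2)))
         \<longlonglongrightarrow> Re ((g (of_real t) * cos (of_real t) - deriv g (of_real t) * sin (of_real t)) / (sin (of_real t))\<^sup>2)"
    by (simp only: Re_sum)
  have "Re (g (of_real (of_int k * pi)) / (cos (of_real (of_int k * pi)) * (of_real t - of_real (of_int k * pi))\<^sup>2))
      = E_fun P Q \<sigma> \<tau> (node \<alpha> k) / (t - of_int k * pi)\<^sup>2" for k
  proof -
    have quot: "axis (slice \<alpha>) (node \<alpha> k) / cos (of_int k * pi) = E_fun P Q \<sigma> \<tau> (node \<alpha> k)"
      unfolding E_at_node by (rule divide_self_inverse[OF cos_int_pi_sq])
    have summand: "g (of_real (of_int k * pi)) / (cos (of_real (of_int k * pi)) * (of_real t - of_real (of_int k * pi))\<^sup>2)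
        = of_real (axis (slice \<alpha>) (node \<alpha> k) / (cos (of_int k * pi) * (t - of_int k * pi)\<^sup>2))"
      unfolding g_node by (simp only: cos_of_real) (simp only: of_real_divide of_real_mult of_real_diff of_real_power)
    show ?thesis
      by (subst summand) (simp only: Re_complex_of_real divide_divide_eq_left[symmetric] quot)
  qed
  moreover have "Re ((g (of_real t) * cos (of_real t) - deriv g (of_real t) * sin (of_real t)) / (sin (of_real t))\<^sup>2)
      = slice_form \<alpha> x / (\<sigma> * (sin t)\<^sup>2)"
  proof -
    have Re_part: "Re ((of_real u - D * of_real v) / of_real r) = (u - Re D * v) / r" for u v r D
      by (simp add: Re_divide_of_real)
    have "(g (of_real t) * cos (of_real t) - deriv g (of_real t) * sin (of_real t)) / (sin (of_real t))\<^sup>2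
        = (of_real (axis (slice \<alpha>) x * cos t) - deriv (slice \<alpha>) (of_real x) * of_real (sin t / \<sigma>)) / of_real ((sin t)\<^sup>2)"
      unfolding g_real pre g_deriv cos_of_real sin_of_real by simp
    then have "Re ((g (of_real t) * cos (of_real t) - deriv g (of_real t) * sin (of_real t)) / (sin (of_real t))\<^sup>2)
        = (axis (slice \<alpha>) x * cos t - axis (deriv (slice \<alpha>)) x * (sin t / \<sigma>)) / (sin t)\<^sup>2"
      by (simp only: Re_part axis_def)
    then show ?thesis using \<sigma> s by (simp add: slice_form_def t_def field_simps)
  qed
  ultimately show ?thesis using lim unfolding t_def by (simp only:)
qed

text \<open>If the sine vanishes, then \<open>x\<close> is itself a node and the form reduces to \<open>\<sigma> * E x\<close>; otherwise it is a
  positive multiple of a limit of sums of nonnegative terms.\<close>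
lemma slice_form_nonneg: "slice_form \<alpha> x \<ge> 0"
proof (cases "sin (\<sigma> * x + \<tau> - \<alpha>) = 0")
  case True
  have "E_fun P Q \<sigma> \<tau> x = axis (slice \<alpha>) x * cos (\<sigma> * x + \<tau> - \<alpha>)"
  proof -
    have "\<sigma> * x + \<tau> = (\<sigma> * x + \<tau> - \<alpha>) + \<alpha>" by simp
    then have "cos (\<sigma> * x + \<tau>) = cos (\<sigma> * x + \<tau> - \<alpha>) * cos \<alpha>"
         "sin (\<sigma> * x + \<tau>) = cos (\<sigma> * x + \<tau> - \<alpha>) * sin \<alpha>"
      using True by (metis cos_add mult_zero_left diff_zero, metis sin_add mult_zero_left add_0)
    then show ?thesis by (simp add: E_fun_def axis_slice algebra_simps)
  qed
  then have "slice_form \<alpha> x = \<sigma> * E_fun P Q \<sigma> \<tau> x" using True by (simp add: slice_form_def)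
  then show ?thesis using \<sigma> E_nonneg[of x] by simp
next
  case False
  have "0 \<le> slice_form \<alpha> x / (\<sigma> * (sin (\<sigma> * x + \<tau> - \<alpha>))\<^sup>2)"
    by (rule LIMSEQ_le_const[OF slice_form_interpolation[OF False]])
       (auto intro!: sum_nonneg divide_nonneg_nonneg E_nonneg)
  moreover have "\<sigma> * (sin (\<sigma> * x + \<tau> - \<alpha>))\<^sup>2 > 0" using False \<sigma> by simp
  ultimately show ?thesis by (simp add: zero_le_divide_iff)
qed

lemma slice_form_zero_imp_E_zero_at_nodes:
  assumes s: "sin (\<sigma> * x + \<tau> - \<alpha>) \<noteq> 0" and z: "slice_form \<alpha> x = 0"
  shows "E_fun P Q \<sigma> \<tau> (node \<alpha> k) = 0"
proof -
  define a where "a = (\<lambda>k. E_fun P Q \<sigma> \<tau> (node \<alpha> k) / (\<sigma> * x + \<tau> - \<alpha> - of_int k * pi)\<^sup>2)"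
  have a: "a k \<ge> 0" for k by (simp add: a_def E_nonneg)
  have lim: "(\<lambda>N. \<Sum>k\<in>{- int N..int N}. a k) \<longlonglongrightarrow> 0"
    using slice_form_interpolation[OF s] by (simp add: z a_def)
  have "incseq (\<lambda>N. \<Sum>k\<in>{- int N..int N}. a k)"
    using a by (auto intro!: incseq_SucI sum_mono2)
  from incseq_le[OF this lim, of "nat \<bar>k\<bar>"]
  have "(\<Sum>k\<in>{- \<bar>k\<bar>..\<bar>k\<bar>}. a k) \<le> 0" by simp
  moreover have "a k \<le> (\<Sum>k\<in>{- \<bar>k\<bar>..\<bar>k\<bar>}. a k)"
    by (rule member_le_sum) (auto intro: a)
  ultimately have "a k = 0" using a[of k] by linarith
  moreover have "\<sigma> * x + \<tau> - \<alpha> - of_int k * pi \<noteq> 0"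
  proof
    assume "\<sigma> * x + \<tau> - \<alpha> - of_int k * pi = 0"
    then have "\<sigma> * x + \<tau> - \<alpha> = of_int k * pi" by simp
    then show False using s sin_zero_iff_int2 by blast
  qed
  ultimately show ?thesis by (simp add: a_def)
qed

text \<open>The coefficients of the slice form with respect to the rotated direction \<open>\<phi> = \<alpha> - \<theta>\<close>; the leading
  one is \<open>\<sigma> * E x\<close>, and \<open>form_b\<close> is the derivative of \<open>E\<close>.\<close>
definition form_b :: "real \<Rightarrow> real" where
  "form_b x =
     (\<sigma> * axis Q x + axis (deriv P) x) * cos (\<sigma> * x + \<tau>)
   + (axis (deriv Q) x - \<sigma> * axis P x) * sin (\<sigma> * x + \<tau>)"

definition form_e :: "real \<Rightarrow> real" where
  "form_e x =
     axis (deriv Q) x * cos (\<sigma> * x + \<tau>) - axis (deriv P) x * sin (\<sigma> * x + \<tau>)"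

lemma slice_form_eq:
  "slice_form (\<sigma> * x + \<tau> + \<phi>) x
   = \<sigma> * E_fun P Q \<sigma> \<tau> x * (cos \<phi>)\<^sup>2 + form_b x * cos \<phi> * sin \<phi> + form_e x * (sin \<phi>)\<^sup>2"
proof -
  define \<theta> where "\<theta> = \<sigma> * x + \<tau>"
  have diff: "\<theta> - (\<theta> + \<phi>) = - \<phi>" by simp
  show ?thesis
    unfolding slice_form_def axis_slice axis_deriv_slice form_b_def form_e_def E_fun_def
      \<theta>_def[symmetric] diff cos_minus sin_minus cos_add sin_add
    by algebra
qed

text \<open>With \<open>F = Q cos \<theta> - P sin \<theta>\<close> and \<open>D = P' cos \<theta> + Q' sin \<theta>\<close> one has \<open>form_b = D + \<sigma> F\<close>,
  \<open>R = D - \<sigma> F\<close> and, since \<open>d\<close> is invariant under rotation of \<open>(P, Q)\<close>, \<open>d = E * form_e - F * D\<close>.\<close>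
lemma discriminant_eq:
  "4 * (\<sigma> * E_fun P Q \<sigma> \<tau> x) * form_e x - (form_b x)\<^sup>2
   = 4 * \<sigma> * d_fun P Q x - (R_fun P Q \<sigma> \<tau> x)\<^sup>2"
proof -
  define c s where "c = cos (\<sigma> * x + \<tau>)" and "s = sin (\<sigma> * x + \<tau>)"
  have cs: "c\<^sup>2 = 1 - s\<^sup>2" unfolding c_def s_def by (simp add: cos_squared_eq)
  define E F D1 where "E = axis P x * c + axis Q x * s" and "F = axis Q x * c - axis P x * s"
    and "D1 = axis (deriv P) x * c + axis (deriv Q) x * s"
  have b: "form_b x = D1 + \<sigma> * F" and R: "R_fun P Q \<sigma> \<tau> x = D1 - \<sigma> * F"
    by (simp_all add: form_b_def R_fun_def D1_def F_def c_def s_def algebra_simps)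
  have "E * form_e x - F * D1 = d_fun P Q x * (c\<^sup>2 + s\<^sup>2)"
    unfolding E_def F_def D1_def form_e_def d_fun_def c_def[symmetric] s_def[symmetric] by algebra
  then have d: "d_fun P Q x = E * form_e x - F * D1" by (simp add: cs)
  have E: "E_fun P Q \<sigma> \<tau> x = E" by (simp add: E_fun_def E_def c_def s_def)
  show ?thesis unfolding b R d E by (simp add: power2_eq_square algebra_simps)
qed

lemma form_nonneg:
  "\<sigma> * E_fun P Q \<sigma> \<tau> x * (cos \<phi>)\<^sup>2 + form_b x * cos \<phi> * sin \<phi> + form_e x * (sin \<phi>)\<^sup>2 \<ge> 0"
  using slice_form_nonneg[of "\<sigma> * x + \<tau> + \<phi>" x] by (simp only: slice_form_eq)

lemma derivative_inequality: "4 * \<sigma> * d_fun P Q x \<ge> (R_fun P Q \<sigma> \<tau> x)\<^sup>2"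
  using quadratic_form_discriminant[OF form_nonneg, of x] discriminant_eq[of x] by simp

lemma form_b_zero: "E_fun P Q \<sigma> \<tau> x = 0 \<Longrightarrow> form_b x = 0"
  using quadratic_form_discriminant[OF form_nonneg, of x] by simp

lemma equality_if_E_zero:
  "E_fun P Q \<sigma> \<tau> x = 0 \<Longrightarrow> 4 * \<sigma> * d_fun P Q x = (R_fun P Q \<sigma> \<tau> x)\<^sup>2"
  using discriminant_eq[of x] form_b_zero[of x] by simp

text \<open>A degenerate form with nonzero leading coefficient vanishes in a direction \<open>\<phi>\<close> with \<open>sin \<phi> \<noteq> 0\<close>.
  There the interpolating sum of nonnegative terms is zero, hence every term is.\<close>
lemma equality_imp_E_zero_at_nodes:
  assumes eq: "4 * \<sigma> * d_fun P Q x = (R_fun P Q \<sigma> \<tau> x)\<^sup>2" and E: "E_fun P Q \<sigma> \<tau> x \<noteq> 0"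
  shows "\<exists>\<alpha>. \<forall>k. E_fun P Q \<sigma> \<tau> (node \<alpha> k) = 0"
proof -
  obtain \<phi> where "sin \<phi> \<noteq> 0" "slice_form (\<sigma> * x + \<tau> + \<phi>) x = 0"
    using quadratic_form_isotropic[OF form_nonneg, of x] discriminant_eq[of x] eq E \<sigma>
    by (auto simp: slice_form_eq)
  then show ?thesis
    using slice_form_zero_imp_E_zero_at_nodes[of x "\<sigma> * x + \<tau> + \<phi>"] by auto
qed

section \<open>Rigidity\<close>

lemma vanishing_at_nodes:
  assumes f: "f \<in> sublinear_class \<sigma>" and zero: "\<And>k. f (of_real (node \<alpha> k)) = 0"
  shows "\<exists>c. \<forall>z. f z = c * sin (of_real \<sigma> * z + of_real (\<tau> - \<alpha>))"
proof -
  define g where "g = (\<lambda>z. f ((z - of_real (\<tau> - \<alpha>)) / of_real \<sigma>))"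
  have "g (of_real (of_int k * pi)) = 0" for k
    using zero[of k] by (simp add: g_def node_def algebra_simps)
  then obtain c where c: "\<And>z. g z = c * sin z"
    using sublinear_class_vanishing_on_sine_zeros[of g] sublinear_class_rescale[OF f \<sigma>, of "\<tau> - \<alpha>"]
    unfolding g_def by blast
  have "f z = c * sin (of_real \<sigma> * z + of_real (\<tau> - \<alpha>))" for z
    using c[of "of_real \<sigma> * z + of_real (\<tau> - \<alpha>)"] \<sigma> by (simp add: g_def)
  then show ?thesis by blast
qed

text \<open>The slice in the orthogonal direction; together with \<open>slice \<alpha>\<close> it determines \<open>P\<close> and \<open>Q\<close>.\<close>
lemma slice_shift: "slice (\<alpha> + pi / 2) z = of_real (cos \<alpha>) * Q z - of_real (sin \<alpha>) * P z"
  by (simp add: slice_def cos_add sin_add)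

text \<open>Let \<open>\<psi> = \<theta> - \<alpha>\<close>, let \<open>G\<close> be the slice in direction \<open>\<alpha>\<close> and \<open>H\<close> the one orthogonal to it, so that
  \<open>E = G cos \<psi> + H sin \<psi>\<close>. Zeros of \<open>E\<close> at the nodes are zeros of \<open>G\<close>, whence \<open>G = \<gamma> sin \<psi>\<close>. Since
  \<open>E \<ge> 0\<close>, these zeros are double, and the first-order condition \<open>form_b = 0\<close> says that \<open>H + \<gamma> cos \<psi>\<close>
  vanishes at the nodes as well; hence it is \<open>c sin \<psi>\<close>, and \<open>E = c sin\<^sup>2 \<psi>\<close>.\<close>
lemma E_zero_at_nodes_imp_canonical_form:
  assumes zero: "\<And>k. E_fun P Q \<sigma> \<tau> (node \<alpha> k) = 0"
  shows "\<exists>c\<ge>0. \<exists>\<gamma>. canonical_form P Q \<sigma> \<tau> c (- \<alpha>) \<gamma>"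
proof -
  define \<psi> where "\<psi> = (\<lambda>x. \<sigma> * x + \<tau> - \<alpha>)"
  have \<psi>_node: "\<psi> (node \<alpha> k) = of_int k * pi" for k using phase_at_node[of \<alpha> k] by (simp add: \<psi>_def)
  have \<psi>_complex: "of_real \<sigma> * of_real x + of_real (\<tau> - \<alpha>) = complex_of_real (\<psi> x)" for x
    by (simp add: \<psi>_def)
  have cos_ne: "cos (of_int k * pi) \<noteq> 0" for k using cos_int_pi_sq[of k] by auto
  have "axis (slice \<alpha>) (node \<alpha> k) = 0" for k
    using zero[of k] cos_ne[of k] by (simp add: E_at_node)
  then have "slice \<alpha> (of_real (node \<alpha> k)) = 0" for k by (simp add: slice_real)
  then obtain c1 where c1: "\<And>z. slice \<alpha> z = c1 * sin (of_real \<sigma> * z + of_real (\<tau> - \<alpha>))"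
    using vanishing_at_nodes[OF slice_class] by blast
  define \<gamma> where "\<gamma> = Re c1"
  have G: "axis (slice \<alpha>) x = \<gamma> * sin (\<psi> x)" for x
    unfolding axis_def c1 \<psi>_complex by (simp add: sin_of_real \<gamma>_def)
  have dG: "axis (deriv (slice \<alpha>)) (node \<alpha> k) = \<gamma> * \<sigma> * cos (of_int k * pi)" for k
  proof -
    have "(axis (slice \<alpha>) has_real_derivative \<gamma> * \<sigma> * cos (of_int k * pi)) (at (node \<alpha> k))"
      unfolding G[abs_def] \<psi>_node[of k, symmetric] by (auto simp: \<psi>_def intro!: derivative_eq_intros)
    then show ?thesis
      using axis_has_derivative[OF sublinear_class_holomorphic[OF slice_class]] DERIV_unique by blast
  qed
  define H where "H = slice (\<alpha> + pi / 2)"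
  define H2 where "H2 = (\<lambda>z. H z + of_real \<gamma> * cos (of_real \<sigma> * z + of_real (\<tau> - \<alpha>)))"
  have "H2 \<in> sublinear_class \<sigma>"
    unfolding H2_def H_def using \<sigma>
    by (intro sublinear_class_add sublinear_class_mult_left slice_class cos_sublinear_class) auto
  moreover have "H2 (of_real (node \<alpha> k)) = 0" for k
  proof -
    define \<kappa> where "\<kappa> = cos (of_int k * pi)"
    have phases: "cos (of_int k * pi + \<alpha>) = \<kappa> * cos \<alpha>" "sin (of_int k * pi + \<alpha>) = \<kappa> * sin \<alpha>"
      unfolding \<kappa>_def cos_add sin_add sin_int_pi by simp_all
    have "form_b (node \<alpha> k) = \<kappa> * (\<sigma> * axis H (node \<alpha> k) + axis (deriv (slice \<alpha>)) (node \<alpha> k))"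
      unfolding form_b_def phase_at_node phases H_def axis_deriv_slice axis_slice
      by (simp add: cos_add sin_add algebra_simps)
    also have "\<dots> = \<kappa> * (\<sigma> * (axis H (node \<alpha> k) + \<gamma> * \<kappa>))"
      unfolding dG \<kappa>_def by (simp only: algebra_simps)
    finally have "axis H (node \<alpha> k) + \<gamma> * cos (of_int k * pi) = 0"
      using form_b_zero[OF zero[of k]] cos_ne[of k] \<sigma> unfolding \<kappa>_def by (metis less_irrefl mult_eq_0_iff)
    moreover have "H2 (of_real (node \<alpha> k)) = of_real (axis H (node \<alpha> k) + \<gamma> * cos (of_int k * pi))"
      unfolding H2_def \<psi>_complex \<psi>_node cos_of_real H_def slice_real by simp
    ultimately show ?thesis by simp
  qed
  ultimately obtain c2 where c2: "\<And>z. H2 z = c2 * sin (of_real \<sigma> * z + of_real (\<tau> - \<alpha>))"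
    using vanishing_at_nodes by blast
  define c where "c = Re c2"
  have H: "axis H x = c * sin (\<psi> x) - \<gamma> * cos (\<psi> x)" for x
  proof -
    have "Re (H2 (of_real x)) = c * sin (\<psi> x)"
      unfolding c2 \<psi>_complex by (simp add: sin_of_real c_def)
    moreover have "Re (H2 (of_real x)) = axis H x + \<gamma> * cos (\<psi> x)"
      unfolding H2_def \<psi>_complex by (simp add: cos_of_real axis_def)
    ultimately show ?thesis by simp
  qed
  have rot: "u = cos \<alpha> * (cos \<alpha> * u + sin \<alpha> * v) - sin \<alpha> * (cos \<alpha> * v - sin \<alpha> * u)"
    "v = sin \<alpha> * (cos \<alpha> * u + sin \<alpha> * v) + cos \<alpha> * (cos \<alpha> * v - sin \<alpha> * u)" for u v
    using sin_cos_squared_add3[of \<alpha>] by algebra+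
  have HPQ: "axis H x = cos \<alpha> * axis Q x - sin \<alpha> * axis P x" for x
    by (simp add: H_def axis_def slice_shift)
  have Px: "axis P x = cos \<alpha> * (\<gamma> * sin (\<psi> x)) - sin \<alpha> * (c * sin (\<psi> x) - \<gamma> * cos (\<psi> x))"
   and Qx: "axis Q x = sin \<alpha> * (\<gamma> * sin (\<psi> x)) + cos \<alpha> * (c * sin (\<psi> x) - \<gamma> * cos (\<psi> x))" for x
    using rot(1)[of "axis P x" "axis Q x"] rot(2)[where u = "axis P x" and v = "axis Q x"]
    unfolding G[symmetric] H[symmetric] HPQ axis_slice by simp_all
  have phase: "\<sigma> * x + \<tau> = \<psi> x + \<alpha>" for x by (simp add: \<psi>_def)
  have canon: "canonical_form P Q \<sigma> \<tau> c (- \<alpha>) \<gamma>"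
    unfolding canonical_form_def phase Px Qx by (simp add: cos_add sin_add algebra_simps)
  have "c \<ge> 0"
  proof -
    \<comment> \<open>At the midpoint between two nodes \<open>E\<close> takes the value \<open>c\<close>.\<close>
    define x where "x = (pi / 2 + \<alpha> - \<tau>) / \<sigma>"
    have x: "\<psi> x = pi / 2" using \<sigma> by (simp add: \<psi>_def x_def)
    have "E_fun P Q \<sigma> \<tau> x = c * (cos \<alpha> * cos \<alpha>) + c * (sin \<alpha> * sin \<alpha>)"
      unfolding E_fun_def phase Px Qx x cos_add sin_add by (simp add: algebra_simps)
    also have "\<dots> = c" using sin_cos_squared_add3[of \<alpha>] by algebra
    finally have "E_fun P Q \<sigma> \<tau> x = c" .
    then show ?thesis using E_nonneg[of x] by simp
  qed
  then show ?thesis using canon by blast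
qed

lemma canonical_form_E:
  assumes "canonical_form P Q \<sigma> \<tau> c \<beta> \<gamma>"
  shows "E_fun P Q \<sigma> \<tau> x = c * (sin (\<sigma> * x + \<tau> + \<beta>))\<^sup>2"
proof -
  define \<theta> where "\<theta> = \<sigma> * x + \<tau>"
  have Px: "axis P x = c * sin \<beta> * sin (\<theta> + \<beta>) + \<gamma> * sin \<theta>"
   and Qx: "axis Q x = c * cos \<beta> * sin (\<theta> + \<beta>) - \<gamma> * cos \<theta>"
    using assms by (auto simp: canonical_form_def \<theta>_def)
  have "E_fun P Q \<sigma> \<tau> x = c * sin (\<theta> + \<beta>) * (sin \<theta> * cos \<beta> + cos \<theta> * sin \<beta>)"
    unfolding E_fun_def Px Qx \<theta>_def[symmetric] by (simp add: algebra_simps)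
  then show ?thesis by (simp add: power2_eq_square \<theta>_def flip: sin_add)
qed

lemma canonical_form_d_R:
  assumes can: "canonical_form P Q \<sigma> \<tau> c \<beta> \<gamma>"
  shows "d_fun P Q x = \<gamma>\<^sup>2 * \<sigma>" and "R_fun P Q \<sigma> \<tau> x = 2 * \<sigma> * \<gamma>"
proof -
  have Pf: "axis P = (\<lambda>x. c * sin \<beta> * sin (\<sigma> * x + \<tau> + \<beta>) + \<gamma> * sin (\<sigma> * x + \<tau>))"
   and Qf: "axis Q = (\<lambda>x. c * cos \<beta> * sin (\<sigma> * x + \<tau> + \<beta>) - \<gamma> * cos (\<sigma> * x + \<tau>))"
    using can by (auto simp: canonical_form_def)
  have "(axis P has_real_derivative \<sigma> * (c * sin \<beta> * cos (\<sigma> * x + \<tau> + \<beta>) + \<gamma> * cos (\<sigma> * x + \<tau>))) (at x)"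
    unfolding Pf by (auto intro!: derivative_eq_intros simp: algebra_simps)
  then have dP: "axis (deriv P) x = \<sigma> * (c * sin \<beta> * cos (\<sigma> * x + \<tau> + \<beta>) + \<gamma> * cos (\<sigma> * x + \<tau>))"
    using axis_has_derivative[OF P_holomorphic] DERIV_unique by blast
  have "(axis Q has_real_derivative \<sigma> * (c * cos \<beta> * cos (\<sigma> * x + \<tau> + \<beta>) + \<gamma> * sin (\<sigma> * x + \<tau>))) (at x)"
    unfolding Qf by (auto intro!: derivative_eq_intros simp: algebra_simps)
  then have dQ: "axis (deriv Q) x = \<sigma> * (c * cos \<beta> * cos (\<sigma> * x + \<tau> + \<beta>) + \<gamma> * sin (\<sigma> * x + \<tau>))"
    using axis_has_derivative[OF Q_holomorphic] DERIV_unique by blast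
  define s t b1 b2 where "s = sin (\<sigma> * x + \<tau>)" and "t = cos (\<sigma> * x + \<tau>)"
    and "b1 = sin \<beta>" and "b2 = cos \<beta>"
  have add: "sin (\<sigma> * x + \<tau> + \<beta>) = s * b2 + t * b1" "cos (\<sigma> * x + \<tau> + \<beta>) = t * b2 - s * b1"
    by (simp_all add: s_def t_def b1_def b2_def sin_add cos_add)
  have st: "s * s = 1 - t * t" "b1 * b1 = 1 - b2 * b2"
    using sin_squared_eq[of "\<sigma> * x + \<tau>"] sin_squared_eq[of \<beta>]
    by (simp_all add: s_def t_def b1_def b2_def power2_eq_square)
  show "d_fun P Q x = \<gamma>\<^sup>2 * \<sigma>"
    unfolding d_fun_def dP dQ unfolding Pf Qf add s_def[symmetric] t_def[symmetric] b1_def[symmetric] b2_def[symmetric]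
    using st by algebra
  show "R_fun P Q \<sigma> \<tau> x = 2 * \<sigma> * \<gamma>"
    unfolding R_fun_def dP dQ unfolding Pf Qf add s_def[symmetric] t_def[symmetric] b1_def[symmetric] b2_def[symmetric]
    using st by algebra
qed

end

section \<open>The inequality and its cases of equality\<close>

theorem theorem1p1:
  fixes \<sigma> \<tau> :: real and P Q \<omega> :: "complex \<Rightarrow> complex"
  assumes "\<sigma> > 0"
    and "P \<in> exp_class \<sigma>" and "Q \<in> exp_class \<sigma>"
    and "real_on_axis P" and "real_on_axis Q"
    and "\<omega> = (\<lambda>z. P z + \<i> * Q z)"
    and "(\<lambda>x::real. \<omega> (complex_of_real x)) \<in> o[at_top](\<lambda>x. complex_of_real x)"
    and "(\<lambda>x::real. \<omega> (complex_of_real x)) \<in> o[at_bot](\<lambda>x. complex_of_real x)"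
    and "\<forall>x. E_fun P Q \<sigma> \<tau> x \<ge> 0"
  shows
    \<comment> \<open>1)\<close>
    "(\<forall>x. 4 * \<sigma> * d_fun P Q x \<ge> (R_fun P Q \<sigma> \<tau> x)\<^sup>2) \<and>
    \<comment> \<open>2)\<close>
     ((\<forall>x. 4 * \<sigma> * d_fun P Q x = (R_fun P Q \<sigma> \<tau> x)\<^sup>2) \<longleftrightarrow>
      (\<exists>c\<ge>0. \<exists>\<beta>. \<forall>x. E_fun P Q \<sigma> \<tau> x = c * (sin (\<sigma> * x + \<tau> + \<beta>))\<^sup>2)) \<and>
     ((\<exists>c\<ge>0. \<exists>\<beta>. \<forall>x. E_fun P Q \<sigma> \<tau> x = c * (sin (\<sigma> * x + \<tau> + \<beta>))\<^sup>2) \<longleftrightarrow>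
      (\<exists>\<beta>. \<forall>k::int. E_fun P Q \<sigma> \<tau> ((of_int k * pi - \<beta> - \<tau>) / \<sigma>) = 0)) \<and>
     ((\<exists>\<beta>. \<forall>k::int. E_fun P Q \<sigma> \<tau> ((of_int k * pi - \<beta> - \<tau>) / \<sigma>) = 0) \<longleftrightarrow>
      (\<exists>c\<ge>0. \<exists>\<beta> \<gamma>. canonical_form P Q \<sigma> \<tau> c \<beta> \<gamma>)) \<and>
     (\<forall>c\<ge>0. \<forall>\<beta> \<gamma>. canonical_form P Q \<sigma> \<tau> c \<beta> \<gamma> \<longrightarrow> (\<forall>x. d_fun P Q x = \<gamma>\<^sup>2 * \<sigma>)) \<and>
    \<comment> \<open>3)\<close>
     ((\<forall>\<alpha>. \<forall>c\<ge>0. \<not> (\<forall>x. E_fun P Q \<sigma> \<tau> x = c * (sin (\<sigma> * x + \<tau> + \<alpha>))\<^sup>2)) \<longrightarrow>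
      (\<forall>x\<^sub>0. 4 * \<sigma> * d_fun P Q x\<^sub>0 = (R_fun P Q \<sigma> \<tau> x\<^sub>0)\<^sup>2 \<longleftrightarrow> E_fun P Q \<sigma> \<tau> x\<^sub>0 = 0))"
proof -
  have hol: "P holomorphic_on UNIV" "Q holomorphic_on UNIV"
    using assms(2,3) by (auto simp: exp_class_def exponential_type_def)
  have \<omega>_real: "\<omega> (of_real x) = Complex (axis P x) (axis Q x)" for x
    using assms(4,5) by (simp add: assms(6) real_on_axis_eq Complex_eq)
  have \<omega>_bound: "\<exists>C. \<forall>x. norm (\<omega> (of_real x)) \<le> \<epsilon> * \<bar>x\<bar> + C" if "\<epsilon> > 0" for \<epsilon>
  proof (rule smallo_imp_affine_bound[OF assms(7,8) _ that])
    have "continuous_on UNIV \<omega>"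
      unfolding assms(6) by (intro holomorphic_on_imp_continuous_on holomorphic_intros hol)
    then show "continuous_on UNIV (\<lambda>x::real. \<omega> (of_real x))"
      by (rule continuous_on_compose2) (auto intro!: continuous_on_of_real continuous_on_id)
  qed
  have P_le: "norm (P (of_real x)) \<le> norm (\<omega> (of_real x))" for x
    using assms(4) abs_Re_le_cmod[of "\<omega> (of_real x)"] by (simp add: \<omega>_real real_on_axis_eq)
  have Q_le: "norm (Q (of_real x)) \<le> norm (\<omega> (of_real x))" for x
    using assms(5) abs_Im_le_cmod[of "\<omega> (of_real x)"] by (simp add: \<omega>_real real_on_axis_eq)
  have P: "P \<in> sublinear_class \<sigma>"
    using assms(1) P_le \<omega>_bound by (intro sublinear_classI assms(2)) (simp, meson order_trans)
  have Q: "Q \<in> sublinear_class \<sigma>"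
    using assms(1) Q_le \<omega>_bound by (intro sublinear_classI assms(3)) (simp, meson order_trans)
  interpret real_pair \<sigma> \<tau> P Q
    by unfold_locales (use assms P Q in auto)
  let ?i = "\<forall>x. 4 * \<sigma> * d_fun P Q x = (R_fun P Q \<sigma> \<tau> x)\<^sup>2"
  let ?ii = "\<exists>c\<ge>0. \<exists>\<beta>. \<forall>x. E_fun P Q \<sigma> \<tau> x = c * (sin (\<sigma> * x + \<tau> + \<beta>))\<^sup>2"
  let ?iii = "\<exists>\<beta>. \<forall>k::int. E_fun P Q \<sigma> \<tau> ((of_int k * pi - \<beta> - \<tau>) / \<sigma>) = 0"
  let ?iv = "\<exists>c\<ge>0. \<exists>\<beta> \<gamma>. canonical_form P Q \<sigma> \<tau> c \<beta> \<gamma>"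
  have node_eq: "node (- \<beta>) k = (of_int k * pi - \<beta> - \<tau>) / \<sigma>" for \<beta> k
    by (simp add: node_def)
  have iii_iv: ?iv if iii: ?iii
  proof -
    obtain \<beta> where "\<And>k. E_fun P Q \<sigma> \<tau> (node (- \<beta>) k) = 0" using iii unfolding node_eq by blast
    then show ?thesis using E_zero_at_nodes_imp_canonical_form[of "- \<beta>"] by blast
  qed
  have iv_ii: ?ii if ?iv using that canonical_form_E by blast
  have ii_iii: ?iii if ii: ?ii
  proof -
    obtain c \<beta> where E: "\<And>x. E_fun P Q \<sigma> \<tau> x = c * (sin (\<sigma> * x + \<tau> + \<beta>))\<^sup>2" using ii by blast
    have "E_fun P Q \<sigma> \<tau> (node (- \<beta>) k) = 0" for k by (simp add: E phase_at_node sin_int_pi)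
    then show ?thesis unfolding node_eq by blast
  qed
  have iv_i: ?i if iv: ?iv
  proof -
    obtain c \<beta> \<gamma> where "canonical_form P Q \<sigma> \<tau> c \<beta> \<gamma>" using iv by blast
    then show ?thesis by (simp add: canonical_form_d_R power2_eq_square)
  qed
  have equality_ii: ?ii if eq: "4 * \<sigma> * d_fun P Q x = (R_fun P Q \<sigma> \<tau> x)\<^sup>2" "E_fun P Q \<sigma> \<tau> x \<noteq> 0" for x
  proof -
    obtain \<alpha> where "\<And>k. E_fun P Q \<sigma> \<tau> (node \<alpha> k) = 0"
      using equality_imp_E_zero_at_nodes[OF eq] by blast
    then have ?iv using E_zero_at_nodes_imp_canonical_form[of \<alpha>] by blast
    then show ?thesis by (rule iv_ii)
  qed
  have i_ii: ?ii if i: ?i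
  proof (cases "\<forall>x. E_fun P Q \<sigma> \<tau> x = 0")
    case True
    then show ?thesis by (intro exI[of _ 0]) auto
  next
    case False
    then show ?thesis using i equality_ii by blast
  qed
  have equality_iff_E_zero: "4 * \<sigma> * d_fun P Q x = (R_fun P Q \<sigma> \<tau> x)\<^sup>2 \<longleftrightarrow> E_fun P Q \<sigma> \<tau> x = 0" if "\<not> ?ii" for x
    using that equality_ii equality_if_E_zero by blast
  have not_ii: "\<not> ?ii"
    if "\<forall>\<alpha>. \<forall>c\<ge>0. \<not> (\<forall>x. E_fun P Q \<sigma> \<tau> x = c * (sin (\<sigma> * x + \<tau> + \<alpha>))\<^sup>2)"
    using that by blast
  show ?thesis
  proof (intro conjI)
    show "\<forall>x. 4 * \<sigma> * d_fun P Q x \<ge> (R_fun P Q \<sigma> \<tau> x)\<^sup>2"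
      by (intro allI derivative_inequality)
    show "?i \<longleftrightarrow> ?ii" by (rule iffI[OF i_ii iv_i[OF iii_iv[OF ii_iii]]])
    show "?ii \<longleftrightarrow> ?iii" by (rule iffI[OF ii_iii iv_ii[OF iii_iv]])
    show "?iii \<longleftrightarrow> ?iv" by (rule iffI[OF iii_iv ii_iii[OF iv_ii]])
    show "\<forall>c\<ge>0. \<forall>\<beta> \<gamma>. canonical_form P Q \<sigma> \<tau> c \<beta> \<gamma> \<longrightarrow> (\<forall>x. d_fun P Q x = \<gamma>\<^sup>2 * \<sigma>)"
      by (intro allI impI) (rule canonical_form_d_R(1))
  qed (rule impI, rule allI, rule equality_iff_E_zero, erule not_ii)
qed

end
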